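(* Assume the weight sequences satisfy the Weight regularity condition and that the limit $W$ satisfies either (i) $\mathbb E[W^4]<\infty$ or (ii) the power-law tail condition with exponent $\tau\in(3,5]$. Let $\beta_c={\rm asinh}(1/\nu)$ with $\nu=\mathbb E[W^2]/\mathbb E[W]$. Then the annealed critical exponents of the annealed Ising model on $\mathrm{GRG}_N(\boldsymbol w)$ exist and satisfy: if $\mathbb E[W^4]<\infty$: $\boldsymbol\beta=1/2$, $\boldsymbol\delta=3$, $\boldsymbol\gamma=\boldsymbol\gamma'=1$; if $W$ satisfies the power-law condition with $\tau\in(3,5)$: $\boldsymbol\beta=1/(\tau-3)$, $\boldsymbol\delta=\tau-2$, $\boldsymbol\gamma=\boldsymbol\gamma'=1$. In the boundary case $\tau=5$ (power-law condition with $\tau=5$), \[ \widetilde M(\beta,0^+)\asymp \Big(\frac{\beta-\beta_c}{\log(1/(\beta-\beta_c))}\Big)^{1/2}\ \text{ as }\beta\searrow\beta_c,\qquad \widetilde M(\beta_c,B)\asymp\Big(\frac{B}{\log(1/B)}\Big)^{1/3}\ \text{ as }B\searrow 0. \] The same statements hold for the rank-1 inhomogeneous Curie–Weiss model, where the quantities are defined by the same formulas with $\sinh(\beta)$ replaced by $\beta$ and with critical value $\beta_c=1/\nu$.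
   Context: Vertex weights $\boldsymbol w=(w_i)_{i\in[N]}$, $w_i>0$, $\ell_N=\sum_{i\in[N]}w_i$. The generalized random graph $\mathrm{GRG}_N(\boldsymbol w)$ on $[N]$ has independent edges, edge $ij$ present with probability $p_{ij}=w_iw_j/(\ell_N+w_iw_j)$. Let $U_N$ be uniform on $[N]$ and $W_N=w_{U_N}$. Weight regularity condition: there is a random variable $W$ with $W_N\to W$ in distribution, $\mathbb E[W_N^2]=\frac1N\sum_i w_i^2\to\mathbb E[W^2]<\infty$, and $\mathbb E[W]>0$. Power-law tail condition with exponent $\tau$: there exist constants $C_W>c_W>0$ and $w_0>1$ with $c_Ww^{-(\tau-1)}\le \mathbb P(W>w)\le C_Ww^{-(\tau-1)}$ for all $w>w_0$. Annealed Ising model: with $Q_N$ the law of the graph, the annealed measure is $P_N(\sigma)=Q_N\big(\exp[\beta\sum_{(i,j)\in E_N}\sigma_i\sigma_j+B\sum_i\sigma_i]\big)/Q_N(Z_N(\beta,B))$ on $\sigma\in\{-1,1\}^N$, $Z_N$ the partition function. Rank-1 inhomogeneous Curie–Weiss model: measure on $\{-1,1\}^N$ proportional to $\exp\big(\frac12\sum_{i,j\in[N]}J_{ij}\sigma_i\sigma_j+B\sum_i\sigma_i\big)$ with $J_{ij}=\beta w_iw_j/\ell_N$. Limiting annealed quantities (for $\mathrm{GRG}$): let $\alpha(\beta)=\sqrt{\sinh(\beta)/\mathbb E[W]}$. For $B>0$, let $z^*(\beta,B)$ be the unique positive solution of $z=\mathbb E[\tanh(\alpha(\beta)Wz+B)\,\alpha(\beta)W]$,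 and set $\widetilde M(\beta,B)=\mathbb E[\tanh(\alpha(\beta)Wz^*+B)]$ (the limiting annealed magnetization per vertex), $\widetilde M(\beta,0^+)=\lim_{B\searrow0}\widetilde M(\beta,B)$, $\widetilde\chi(\beta,B)=\partial_B\widetilde M(\beta,B)$ (the limiting annealed susceptibility), $\widetilde\chi(\beta,0^+)=\lim_{B\searrow0}\widetilde\chi(\beta,B)$. Critical exponents: $\widetilde M(\beta,0^+)\asymp(\beta-\beta_c)^{\boldsymbol\beta}$ as $\beta\searrow\beta_c$; $\widetilde M(\beta_c,B)\asymp B^{1/\boldsymbol\delta}$ as $B\searrow0$; $\widetilde\chi(\beta,0^+)\asymp(\beta_c-\beta)^{-\boldsymbol\gamma}$ as $\beta\nearrow\beta_c$; $\widetilde\chi(\beta,0^+)\asymp(\beta-\beta_c)^{-\boldsymbol\gamma'}$ as $\beta\searrow\beta_c$. Here $f\asymp g$ means $f/g$ is bounded away from $0$ and $\infty$ in the specified limit. *)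

theory Defs
  imports "HOL-Probability.Probability" "HOL-Library.Landau_Symbols"
begin

text \<open>The law of the limiting weight W is a real distribution M; W is the identity on M.
  The parameter sh is sinh for the annealed GRG and the identity for rank-1 inhomogeneous
  Curie-Weiss.\<close>

definition EW :: "real measure \<Rightarrow> real" where
  "EW M = (\<integral>x. x \<partial>M)"

definition alpha :: "real measure \<Rightarrow> (real \<Rightarrow> real) \<Rightarrow> real \<Rightarrow> real" where
  "alpha M sh \<beta> = sqrt (sh \<beta> / EW M)"

definition zstar :: "real measure \<Rightarrow> (real \<Rightarrow> real) \<Rightarrow> real \<Rightarrow> real \<Rightarrow> real" where
  "zstar M sh \<beta> B = (THE z. z > 0 \<and>
      z = (\<integral>x. tanh (alpha M sh \<beta> * x * z + B) * (alpha M sh \<beta> * x) \<partial>M))"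

definition Mtil :: "real measure \<Rightarrow> (real \<Rightarrow> real) \<Rightarrow> real \<Rightarrow> real \<Rightarrow> real" where
  "Mtil M sh \<beta> B = (\<integral>x. tanh (alpha M sh \<beta> * x * zstar M sh \<beta> B + B) \<partial>M)"

definition Mtil0 :: "real measure \<Rightarrow> (real \<Rightarrow> real) \<Rightarrow> real \<Rightarrow> real" where
  "Mtil0 M sh \<beta> = Lim (at_right 0) (Mtil M sh \<beta>)"

definition chitil :: "real measure \<Rightarrow> (real \<Rightarrow> real) \<Rightarrow> real \<Rightarrow> real \<Rightarrow> real" where
  "chitil M sh \<beta> B = deriv (Mtil M sh \<beta>) B"

definition chitil0 :: "real measure \<Rightarrow> (real \<Rightarrow> real) \<Rightarrow> real \<Rightarrow> real" where
  "chitil0 M sh \<beta> = Lim (at_right 0) (chitil M sh \<beta>)"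

definition nu :: "real measure \<Rightarrow> real" where
  "nu M = (\<integral>x. x\<^sup>2 \<partial>M) / EW M"

definition has_crit_exps ::
  "real measure \<Rightarrow> (real \<Rightarrow> real) \<Rightarrow> real \<Rightarrow> real \<Rightarrow> real \<Rightarrow> real \<Rightarrow> real \<Rightarrow> bool" where
  "has_crit_exps M sh \<beta>c eb ed eg eg' \<longleftrightarrow>
     Mtil0 M sh \<in> \<Theta>[at_right \<beta>c](\<lambda>\<beta>. (\<beta> - \<beta>c) powr eb) \<and>
     Mtil M sh \<beta>c \<in> \<Theta>[at_right 0](\<lambda>B. B powr (1 / ed)) \<and>
     chitil0 M sh \<in> \<Theta>[at_left \<beta>c](\<lambda>\<beta>. (\<beta>c - \<beta>) powr (- eg)) \<and>
     chitil0 M sh \<in> \<Theta>[at_right \<beta>c](\<lambda>\<beta>. (\<beta> - \<beta>c) powr (- eg'))"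

definition boundary_behaviour :: "real measure \<Rightarrow> (real \<Rightarrow> real) \<Rightarrow> real \<Rightarrow> bool" where
  "boundary_behaviour M sh \<beta>c \<longleftrightarrow>
     Mtil0 M sh \<in> \<Theta>[at_right \<beta>c](\<lambda>\<beta>. ((\<beta> - \<beta>c) / ln (1 / (\<beta> - \<beta>c))) powr (1/2)) \<and>
     Mtil M sh \<beta>c \<in> \<Theta>[at_right 0](\<lambda>B. (B / ln (1 / B)) powr (1/3))"

definition power_law :: "real measure \<Rightarrow> real \<Rightarrow> bool" where
  "power_law M \<tau> \<longleftrightarrow> (\<exists>cW CW w0. CW > cW \<and> cW > 0 \<and> w0 > 1 \<and>
     (\<forall>w>w0. cW * w powr (-(\<tau> - 1)) \<le> measure M {x. x > w} \<and>
             measure M {x. x > w} \<le> CW * w powr (-(\<tau> - 1))))"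

definition emp_law :: "(nat \<Rightarrow> nat \<Rightarrow> real) \<Rightarrow> nat \<Rightarrow> real measure" where
  "emp_law w N = measure_pmf (map_pmf (w N) (pmf_of_set {..<N}))"

definition weight_regular :: "(nat \<Rightarrow> nat \<Rightarrow> real) \<Rightarrow> real measure \<Rightarrow> bool" where
  "weight_regular w M \<longleftrightarrow>
     (\<forall>N i. i < N \<longrightarrow> w N i > 0) \<and>
     real_distribution M \<and>
     weak_conv_m (emp_law w) M \<and>
     integrable M (\<lambda>x. x\<^sup>2) \<and>
     (\<lambda>N. (\<Sum>i<N. (w N i)\<^sup>2) / real N) \<longlonglongrightarrow> (\<integral>x. x\<^sup>2 \<partial>M) \<and>
     EW M > 0"

end

theory Submission
  imports Defs
begin

text \<open>
  With \<theta> = sh \<beta> / E[W] and t = \<alpha> z the fixed-point equation reads t = \<theta> E[W tanh (W t + B)], and \<theta> is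
  critical when \<theta> E[W^2] = 1. Put D(t) = E[W (W t - tanh (W t))]. In zero field above criticality
  the equation becomes D(t) / t = E[W^2] - 1/\<theta>, and on the critical isotherm it gives D(t) \<asymp> B, so both
  magnetization exponents follow from the size of D near 0: D(t) \<asymp> t^3 if the fourth moment is finite,
  t to the power \<tau> - 2 for tails of exponent \<tau> < 5, and t^3 log (1/t) for \<tau> = 5.

  Implicit differentiation expresses the susceptibility as a regular numerator over
  1 - \<theta> E[W^2 sech^2 (W t + B)]. As B tends to 0, below criticality t = 0 and this is of order \<beta>c - \<beta>; above criticality it
  equals (\<theta> / t) E[W k(W t)] with k(s) = tanh s - s sech^2 s. Since c min(s,1)^4 \<le> s k(s) and
  k(s) \<le> 2 (s - tanh s), the last expectation is again comparable to D(t), and the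
  denominator is of order D(t) / t, that is, of order \<beta> - \<beta>c.
\<close>

section \<open>Scalar inequalities for the hyperbolic tangent\<close>

text \<open>In the power-law case W has no fourth moment, so tanh cannot be expanded to third order
  under the expectation. D is therefore kept whole, and its size enters the exponent lemmas as a
  hypothesis. The relevant scale is W = 1/t: s - tanh s is at most cubic below s = 1 and at most
  linear above. Hence t^3 E[min(W, 1/t)^4] controls E[W k(W t)] from below, and it controls D from
  above once the part of E[W^2] beyond 1/t is added. Working with \<theta> puts both models under
  one analysis: of sh only the value and a positive derivative at the critical point are used. The
  zero-field statements rest on monotonicity. Concavity of tanh makes drive(t)/t decrease, and from
  this come uniqueness, comparison of fixed points and convergence to criticality. The quantities
  are defined through \<open>THE\<close>, \<open>Lim\<close> and \<open>deriv\<close>, so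
  uniqueness, existence of both zero-field limits and differentiability in B must be established
  before any of them can be estimated.\<close>

lemma tanh_deriv: "(tanh has_real_derivative 1 - tanh x ^ 2) (at (x::real))"
  by (auto intro!: derivative_eq_intros)

lemma tanh_sq_le_one: "tanh x ^ 2 \<le> (1::real)"
  using tanh_real_lt_1[of x] tanh_real_gt_neg1[of x] by (simp add: abs_square_le_1 abs_le_iff)

lemma tanh_sq_lt_one: "tanh x ^ 2 < (1::real)"
  using tanh_real_lt_1[of x] tanh_real_gt_neg1[of x] by (simp add: abs_square_less_1 abs_less_iff)

lemma tanh_abs_le_one: "\<bar>tanh x\<bar> \<le> (1::real)"
  using tanh_real_lt_1[of x] tanh_real_gt_neg1[of x] by (simp add: abs_le_iff)

definition tanh_gap :: "real \<Rightarrow> real" where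
  "tanh_gap s = s - tanh s"

text \<open>This is the k of the overview. Up to the factor -1/s^2 it is the derivative of tanh s /
  s, so its sign expresses that this quotient decreases for s > 0.\<close>

definition tanh_defect :: "real \<Rightarrow> real" where
  "tanh_defect s = tanh s - s * (1 - tanh s ^ 2)"

lemma tanh_sq_mono: "0 \<le> x \<Longrightarrow> x \<le> y \<Longrightarrow> tanh x ^ 2 \<le> tanh (y::real) ^ 2"
  by (rule power_mono) auto

lemma DERIV_tanh_gap: "(tanh_gap has_real_derivative tanh x ^ 2) (at x)"
  unfolding tanh_gap_def by (auto intro!: derivative_eq_intros tanh_deriv)

lemma DERIV_tanh_defect:
  "(tanh_defect has_real_derivative 2 * x * tanh x * (1 - tanh x ^ 2)) (at x)"
  unfolding tanh_defect_def
  by (auto intro!: derivative_eq_intros tanh_deriv simp: algebra_simps)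

lemma tanh_gap_mono: "x \<le> y \<Longrightarrow> tanh_gap x \<le> tanh_gap y"
  by (rule DERIV_nonneg_imp_nondecreasing) (auto intro!: DERIV_tanh_gap exI)

lemma tanh_gap_nonneg: "0 \<le> x \<Longrightarrow> 0 \<le> tanh_gap x"
  using tanh_gap_mono[of 0 x] by (simp add: tanh_gap_def)

lemma tanh_le_self: "0 \<le> x \<Longrightarrow> tanh x \<le> (x::real)"
  using tanh_gap_nonneg[of x] by (simp add: tanh_gap_def)

lemma tanh_gap_le_self: "0 \<le> x \<Longrightarrow> tanh_gap x \<le> x"
  by (simp add: tanh_gap_def)

lemma tanh_gap_le_cube:
  assumes "0 \<le> x" shows "tanh_gap x \<le> x ^ 3"
proof -
  have "0 ^ 3 - tanh_gap 0 \<le> x ^ 3 - tanh_gap x"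
  proof (rule DERIV_nonneg_imp_nondecreasing[OF assms])
    fix y :: real assume y: "0 \<le> y" "y \<le> x"
    have "tanh y ^ 2 \<le> y ^ 2" using y tanh_le_self by (intro power_mono) auto
    then have "0 \<le> 3 * y ^ 2 - tanh y ^ 2"
      using zero_le_power2[of y] by linarith
    then show "\<exists>D. ((\<lambda>y. y ^ 3 - tanh_gap y) has_real_derivative D) (at y) \<and> 0 \<le> D"
      by (intro exI[of _ "3 * y ^ 2 - tanh y ^ 2"])
         (auto intro!: derivative_eq_intros DERIV_tanh_gap)
  qed
  then show ?thesis by (simp add: tanh_gap_def)
qed

lemma tanh_defect_mono: "0 \<le> x \<Longrightarrow> x \<le> y \<Longrightarrow> tanh_defect x \<le> tanh_defect y"
  by (rule DERIV_nonneg_imp_nondecreasing)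
     (auto intro!: DERIV_tanh_defect exI mult_nonneg_nonneg simp: tanh_sq_le_one)

lemma tanh_defect_nonneg: "0 \<le> x \<Longrightarrow> 0 \<le> tanh_defect x"
  using tanh_defect_mono[of 0 x] by (simp add: tanh_defect_def)

text \<open>The difference of the two sides vanishes at 0 and has derivative 2 tanh y times
  \<open>tanh_defect y\<close>, which is nonnegative.\<close>

lemma tanh_defect_le_gap:
  assumes "0 \<le> x" shows "tanh_defect x \<le> 2 * tanh_gap x"
proof -
  have "2 * tanh_gap 0 - tanh_defect 0 \<le> 2 * tanh_gap x - tanh_defect x"
  proof (rule DERIV_nonneg_imp_nondecreasing[OF assms])
    fix y :: real assume y: "0 \<le> y" "y \<le> x"
    have "0 \<le> 2 * tanh y * tanh_defect y"
      using y tanh_defect_nonneg by simp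
    then have "0 \<le> 2 * tanh y ^ 2 - 2 * y * tanh y * (1 - tanh y ^ 2)"
      by (simp add: tanh_defect_def algebra_simps power2_eq_square)
    then show "\<exists>D. ((\<lambda>y. 2 * tanh_gap y - tanh_defect y) has_real_derivative D) (at y) \<and> 0 \<le> D"
      by (intro exI[of _ "2 * tanh y ^ 2 - 2 * y * tanh y * (1 - tanh y ^ 2)"])
         (auto intro!: derivative_eq_intros DERIV_tanh_gap DERIV_tanh_defect)
  qed
  then show ?thesis by (simp add: tanh_gap_def tanh_defect_def)
qed

text \<open>Near 0 the defect is cubic, and past 1 it is at least its value at 1. The factor s and
  the minimum merge both ranges into one bound, whose expectation is a truncated fourth
  moment.\<close>

lemma tanh_defect_lower:
  obtains c where "0 < c" and "\<And>s. 0 \<le> s \<Longrightarrow> c * (min s 1) ^ 4 \<le> s * tanh_defect s"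
proof
  define b :: real where "b = 1 - tanh 1 ^ 2"
  \<comment> \<open>On [0,1] sech^2 is at least b and tanh y is at least b y, so the defect has
    derivative at least 2 b^2 y^2. The derivative 3 c y^2 = (3/2) b^2 y^2 stays below this.\<close>
  define c where "c = b ^ 2 / 2"
  have b: "0 < b" using tanh_sq_lt_one[of 1] by (simp add: b_def)
  then show "0 < c" by (simp add: c_def)
  have cube: "c * x ^ 3 \<le> tanh_defect x" if x: "0 \<le> x" "x \<le> 1" for x :: real
  proof -
    have "tanh_defect 0 - c * 0 ^ 3 \<le> tanh_defect x - c * x ^ 3"
    proof (rule DERIV_nonneg_imp_nondecreasing[OF x(1)])
      fix y :: real assume y: "0 \<le> y" "y \<le> x"
      have hb: "b \<le> 1 - tanh y ^ 2" using y x tanh_sq_mono[of y 1] by (simp add: b_def)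
      have "y * b \<le> y * (1 - tanh y ^ 2)" using hb y by (intro mult_left_mono) auto
      then have "y * b \<le> tanh y" using tanh_defect_nonneg[of y] y by (simp add: tanh_defect_def)
      then have "2 * y * (y * b) * b \<le> 2 * y * tanh y * (1 - tanh y ^ 2)"
        using y b hb by (intro mult_mono) auto
      moreover have "c * (3 * y ^ 2) \<le> 2 * y * (y * b) * b"
        using b y by (simp add: c_def power2_eq_square)
      ultimately show "\<exists>D. ((\<lambda>y. tanh_defect y - c * y ^ 3) has_real_derivative D) (at y) \<and> 0 \<le> D"
        by (intro exI[of _ "2 * y * tanh y * (1 - tanh y ^ 2) - c * (3 * y ^ 2)"])
           (auto intro!: derivative_eq_intros DERIV_tanh_defect)
    qed
    then show ?thesis by (simp add: tanh_defect_def)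
  qed
  show "c * (min s 1) ^ 4 \<le> s * tanh_defect s" if s: "0 \<le> s" for s
  proof (cases "s \<le> 1")
    case True
    then show ?thesis using mult_left_mono[OF cube[OF s True] s]
      by (simp add: min_def eval_nat_numeral mult_ac)
  next
    case False
    have "c \<le> tanh_defect s" using cube[of 1] tanh_defect_mono[of 1 s] False by simp
    also have "\<dots> \<le> s * tanh_defect s"
      using False tanh_defect_nonneg[of s] by (simp add: mult_le_cancel_right1)
    finally show ?thesis using False by simp
  qed
qed

text \<open>Concavity of tanh on the half-line together with tanh 0 = 0. In this multiplicative form
  it survives the expectation and yields uniqueness and scaling of the fixed point.\<close>

lemma tanh_scale:
  fixes y l :: real
  assumes "0 \<le> l" "l \<le> 1" "0 \<le> y"
  shows "l * tanh y \<le> tanh (l * y)"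
proof -
  have "tanh (l * 0) - l * tanh 0 \<le> tanh (l * y) - l * tanh y"
  proof (rule DERIV_nonneg_imp_nondecreasing[OF assms(3)])
    fix u :: real assume u: "0 \<le> u" "u \<le> y"
    have "l * u \<le> u" using assms u by (simp add: mult_left_le_one_le)
    then have "tanh (l * u) ^ 2 \<le> tanh u ^ 2" using assms u by (intro tanh_sq_mono) auto
    then have "0 \<le> l * (tanh u ^ 2 - tanh (l * u) ^ 2)" using assms by simp
    then show "\<exists>D. ((\<lambda>y. tanh (l * y) - l * tanh y) has_real_derivative D) (at u) \<and> 0 \<le> D"
      by (intro exI[of _ "l * (tanh u ^ 2 - tanh (l * u) ^ 2)"])
         (auto intro!: derivative_eq_intros DERIV_chain2[OF tanh_deriv] tanh_deriv simp: algebra_simps)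
  qed
  then show ?thesis by simp
qed

lemma tanh_increment_lower:
  fixes x y :: real
  assumes "0 \<le> x" "x \<le> y"
  shows "(y - x) * (1 - tanh y ^ 2) \<le> tanh y - tanh x"
proof -
  have "tanh x - x * (1 - tanh y ^ 2) \<le> tanh y - y * (1 - tanh y ^ 2)"
  proof (rule DERIV_nonneg_imp_nondecreasing[OF assms(2)])
    fix u :: real assume u: "x \<le> u" "u \<le> y"
    have "tanh u ^ 2 \<le> tanh y ^ 2" using assms u by (intro tanh_sq_mono) auto
    then show "\<exists>D. ((\<lambda>u. tanh u - u * (1 - tanh y ^ 2)) has_real_derivative D) (at u) \<and> 0 \<le> D"
      by (intro exI[of _ "tanh y ^ 2 - tanh u ^ 2"])
         (auto intro!: derivative_eq_intros tanh_deriv)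
  qed
  then show ?thesis by (simp add: algebra_simps)
qed

text \<open>The divided difference, completed at y = a by the derivative. The increment identity
  then holds for every y, and the slope is continuous at a and bounded by 1, as dominated
  convergence requires.\<close>

definition tanh_slope :: "real \<Rightarrow> real \<Rightarrow> real" where
  "tanh_slope a y = (if y = a then 1 - tanh a ^ 2 else (tanh y - tanh a) / (y - a))"

lemma tanh_slope_mult: "tanh y - tanh a = tanh_slope a y * (y - a)"
  by (simp add: tanh_slope_def)

lemma isCont_tanh_slope: "isCont (tanh_slope a) a"
proof -
  have "(tanh_slope a \<longlongrightarrow> 1 - tanh a ^ 2) (at a)"
    by (rule Lim_transform_eventually[OF tanh_deriv[of a, unfolded has_field_derivative_iff]])
       (auto simp: tanh_slope_def eventually_at_filter)
  then show ?thesis by (simp add: isCont_def tanh_slope_def)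
qed

lemma abs_tanh_slope_le: "\<bar>tanh_slope a y\<bar> \<le> 1"
proof -
  have gen: "\<bar>tanh y - tanh a\<bar> \<le> \<bar>y - a\<bar>" if "a \<le> y" for a y :: real
    using that tanh_gap_mono[OF that] by (simp add: tanh_gap_def)
  have "\<bar>tanh y - tanh a\<bar> \<le> \<bar>y - a\<bar>"
    using gen[of a y] gen[of y a] by (cases "a \<le> y") auto
  then show ?thesis
    using tanh_sq_le_one[of a] by (auto simp: tanh_slope_def divide_le_eq_1)
qed

lemma borel_measurable_tanh [measurable (raw)]:
  fixes f :: "'a \<Rightarrow> real"
  assumes "f \<in> borel_measurable N"
  shows "(\<lambda>x. tanh (f x)) \<in> borel_measurable N"
  by (rule borel_measurable_continuous_on[OF _ assms]) (auto intro!: continuous_intros)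

lemma borel_measurable_tanh_slope [measurable (raw)]:
  fixes f g :: "'a \<Rightarrow> real"
  assumes [measurable]: "f \<in> borel_measurable N" "g \<in> borel_measurable N"
  shows "(\<lambda>x. tanh_slope (f x) (g x)) \<in> borel_measurable N"
  unfolding tanh_slope_def by measurable

section \<open>The mean-field fixed point\<close>

text \<open>Dominated convergence is sequential; testing \<open>at a within S\<close> along all
  sequences tending to a makes one statement serve two-sided and one-sided limits.\<close>

lemma integral_dominated_tendsto_at:
  fixes f :: "real \<Rightarrow> 'a \<Rightarrow> real"
  assumes "\<And>y. f y \<in> borel_measurable N" "l \<in> borel_measurable N" "integrable N w"
    and "\<And>x. ((\<lambda>y. f y x) \<longlongrightarrow> l x) (at a within S)"
    and "\<And>y x. \<bar>f y x\<bar> \<le> w x"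
  shows "((\<lambda>y. \<integral>x. f y x \<partial>N) \<longlongrightarrow> (\<integral>x. l x \<partial>N)) (at a within S)"
  unfolding tendsto_at_iff_sequentially
proof (intro allI impI)
  fix X assume X: "\<forall>i. X i \<in> S - {a}" "X \<longlonglongrightarrow> a"
  have "(\<lambda>i. \<integral>x. f (X i) x \<partial>N) \<longlonglongrightarrow> (\<integral>x. l x \<partial>N)"
  proof (rule integral_dominated_convergence[OF assms(2) assms(1) assms(3)])
    show "AE x in N. (\<lambda>i. f (X i) x) \<longlonglongrightarrow> l x"
      using assms(4) X by (auto simp: tendsto_at_iff_sequentially comp_def)
  qed (use assms(5) in auto)
  then show "((\<lambda>y. \<integral>x. f y x \<partial>N) \<circ> X) \<longlonglongrightarrow> (\<integral>x. l x \<partial>N)"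
    by (simp add: comp_def)
qed

text \<open>The sign of W is not part of \<open>weight_regular\<close>; it is inherited from the
  positive finite-N weights in \<open>weight_regular_imp_weight_law\<close>.\<close>

locale weight_law = real_distribution M for M :: "real measure" +
  assumes nonneg: "AE x in M. 0 \<le> x"
    and integrable_sq: "integrable M (\<lambda>x. x\<^sup>2)"
    and mean_pos: "0 < EW M"
begin

lemma integrable_id: "integrable M (\<lambda>x. x)"
  using square_integrable_imp_integrable[OF _ integrable_sq] by simp

lemma integrable_times_bounded:
  fixes w f :: "real \<Rightarrow> real"
  assumes "integrable M w" "f \<in> borel_measurable M" "\<And>x. \<bar>f x\<bar> \<le> c"
  shows "integrable M (\<lambda>x. w x * f x)"
proof (rule Bochner_Integration.integrable_bound[where f = "\<lambda>x. c * w x"])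
  show "AE x in M. norm (w x * f x) \<le> norm (c * w x)"
  proof (rule AE_I2)
    fix x
    have "\<bar>f x\<bar> * \<bar>w x\<bar> \<le> \<bar>c\<bar> * \<bar>w x\<bar>"
      using assms(3)[of x] by (intro mult_right_mono) auto
    then show "norm (w x * f x) \<le> norm (c * w x)" by (simp add: abs_mult mult.commute)
  qed
qed (use assms in auto)

text \<open>Since E[W] > 0, the law charges the open half-line. This is the source of the strict
  inequalities between expectations below.\<close>

lemma expectation_pos:
  fixes f :: "real \<Rightarrow> real"
  assumes int: "integrable M f" and pos: "\<And>x. 0 < x \<Longrightarrow> 0 < f x" and nn: "0 \<le> f 0"
  shows "0 < (\<integral>x. f x \<partial>M)"
proof -
  have f0: "AE x in M. 0 \<le> f x"
    using nonneg
  proof eventually_elim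
    case (elim x)
    then show ?case using pos[of x] nn by (cases "x = 0") (auto simp: less_imp_le)
  qed
  have "(\<integral>x. f x \<partial>M) \<noteq> 0"
  proof
    assume "(\<integral>x. f x \<partial>M) = 0"
    then have "AE x in M. f x = 0"
      using integral_nonneg_eq_0_iff_AE[OF int f0] by simp
    then have "AE x in M. x = 0"
      using nonneg
    proof eventually_elim
      case (elim x)
      then show ?case using pos[of x] by (cases "x = 0") auto
    qed
    then have "(\<integral>x. x \<partial>M) = (\<integral>x. 0 \<partial>M)" by (intro integral_cong_AE) auto
    then show False using mean_pos by (simp add: EW_def)
  qed
  then show ?thesis using integral_nonneg_AE[OF f0] by simp
qed

definition second_moment :: real where
  "second_moment = (\<integral>x. x\<^sup>2 \<partial>M)"

lemma second_moment_pos: "0 < second_moment"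
  unfolding second_moment_def by (rule expectation_pos[OF integrable_sq]) auto

definition drive :: "real \<Rightarrow> real \<Rightarrow> real" where
  "drive t B = (\<integral>x. x * tanh (x * t + B) \<partial>M)"

definition fixpt :: "real \<Rightarrow> real \<Rightarrow> real" where
  "fixpt \<theta> B = (THE t. 0 < t \<and> t = \<theta> * drive t B)"

lemma integrable_drive: "integrable M (\<lambda>x. x * tanh (x * t + B))"
  by (rule integrable_times_bounded[OF integrable_id]) (auto intro: tanh_abs_le_one)

lemma drive_mono:
  assumes "t \<le> t'" "B \<le> B'" shows "drive t B \<le> drive t' B'"
  unfolding drive_def
proof (rule integral_mono_AE[OF integrable_drive integrable_drive])
  show "AE x in M. x * tanh (x * t + B) \<le> x * tanh (x * t' + B')"
    using nonneg
  proof eventually_elim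
    case (elim x)
    then show ?case
      using assms by (intro mult_left_mono) (auto simp: mult_left_mono add_mono)
  qed
qed

lemma drive_le_mean: "drive t B \<le> EW M"
  unfolding drive_def EW_def
proof (rule integral_mono_AE[OF integrable_drive integrable_id])
  show "AE x in M. x * tanh (x * t + B) \<le> x"
    using nonneg
  proof eventually_elim
    case (elim x)
    then show ?case
      using tanh_real_lt_1[of "x*t+B"] by (simp add: mult_left_le)
  qed
qed

lemma drive_scale:
  assumes "0 \<le> l" "l \<le> 1" "0 \<le> t" "0 \<le> B"
  shows "l * drive t B \<le> drive (l * t) (l * B)"
proof -
  have "(\<integral>x. l * (x * tanh (x * t + B)) \<partial>M) \<le> (\<integral>x. x * tanh (x * (l * t) + l * B) \<partial>M)"
  proof (rule integral_mono_AE[OF integrable_mult_right[OF integrable_drive] integrable_drive])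
    show "AE x in M. l * (x * tanh (x * t + B)) \<le> x * tanh (x * (l * t) + l * B)"
      using nonneg
    proof eventually_elim
      case (elim x)
      have "l * tanh (x * t + B) \<le> tanh (l * (x * t + B))"
        using assms elim by (intro tanh_scale) auto
      from mult_left_mono[OF this elim] show ?case by (simp add: algebra_simps)
    qed
  qed
  then show ?thesis by (simp add: drive_def)
qed

lemma drive_strict_field:
  assumes "B < B'" shows "drive t B < drive t B'"
proof -
  have "0 < (\<integral>x. x * tanh (x * t + B') - x * tanh (x * t + B) \<partial>M)"
    using assms by (intro expectation_pos Bochner_Integration.integrable_diff integrable_drive) auto
  then show ?thesis
    using integrable_drive by (simp add: drive_def)
qed

text \<open>Scaling by t/s lowers the field from B to (t/s) B, and raising it back to B only helps.
  So drive t B / t is nonincreasing in t.\<close>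

lemma drive_ratio_le:
  assumes "0 < t" "t \<le> s" "0 \<le> B" shows "t * drive s B \<le> s * drive t B"
proof -
  have "(t / s) * drive s B \<le> drive ((t / s) * s) ((t / s) * B)"
    using assms by (intro drive_scale) auto
  also have "\<dots> \<le> drive t B" using assms
    by (intro drive_mono) (auto simp: divide_le_eq mult.commute[of t] mult_left_mono)
  finally show ?thesis using assms by (simp add: field_simps)
qed

text \<open>Strictness comes from the field: (t/s) B < B, and \<open>drive\<close> is strictly
  increasing in its second argument.\<close>

lemma drive_ratio_less:
  assumes "0 < t" "t < s" "0 < B" shows "t * drive s B < s * drive t B"
proof -
  have "(t / s) * drive s B \<le> drive ((t / s) * s) ((t / s) * B)"
    using assms by (intro drive_scale) auto
  also have "\<dots> < drive ((t / s) * s) B"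
    using assms by (intro drive_strict_field) (auto simp: field_simps)
  finally show ?thesis using assms by (simp add: field_simps)
qed

lemma tendsto_expectation:
  fixes t B :: "real \<Rightarrow> real" and \<psi> w :: "real \<Rightarrow> real"
  assumes "(t \<longlongrightarrow> t0) (at a within S)" "(B \<longlongrightarrow> B0) (at a within S)"
    and "integrable M w" "continuous_on UNIV \<psi>" "\<And>x. \<bar>\<psi> x\<bar> \<le> 1"
  shows "((\<lambda>y. \<integral>x. w x * \<psi> (x * t y + B y) \<partial>M) \<longlongrightarrow> (\<integral>x. w x * \<psi> (x * t0 + B0) \<partial>M)) (at a within S)"
proof (rule integral_dominated_tendsto_at[where w = "\<lambda>x. \<bar>w x\<bar>"])
  have [measurable]: "w \<in> borel_measurable M" using assms(3) by simp
  have [measurable]: "\<psi> \<in> borel_measurable borel"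
    using assms(4) by (rule borel_measurable_continuous_onI)
  show "(\<lambda>x. w x * \<psi> (x * t y + B y)) \<in> borel_measurable M" for y by measurable
  show "(\<lambda>x. w x * \<psi> (x * t0 + B0)) \<in> borel_measurable M" by measurable
  have iso: "isCont \<psi> y" for y using assms(4) by (simp add: continuous_on_eq_continuous_at)
  show "((\<lambda>y. w x * \<psi> (x * t y + B y)) \<longlongrightarrow> w x * \<psi> (x * t0 + B0)) (at a within S)" for x
    by (intro tendsto_intros isCont_tendsto_compose[OF iso] assms)
  show "\<bar>w x * \<psi> (x * t y + B y)\<bar> \<le> \<bar>w x\<bar>" for x y
    using assms(5) by (simp add: abs_mult mult_left_le)
qed (use assms in auto)

lemma tendsto_drive:
  fixes t B :: "real \<Rightarrow> real"
  assumes "(t \<longlongrightarrow> t0) (at a within S)" "(B \<longlongrightarrow> B0) (at a within S)"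
  shows "((\<lambda>y. drive (t y) (B y)) \<longlongrightarrow> drive t0 B0) (at a within S)"
  unfolding drive_def
  by (rule tendsto_expectation[OF assms integrable_id])
     (auto intro!: continuous_intros tanh_abs_le_one)

text \<open>A larger s would contradict the strict decrease of drive t B / t. Since s need only be a
  subsolution, the same argument is a comparison principle, which later gives monotonicity and
  scaling of the fixed point in B.\<close>

lemma fixpt_unique:
  assumes "0 < t" "t = \<theta> * drive t B" "0 < s" "s \<le> \<theta> * drive s B" "0 < \<theta>" "0 < B"
  shows "s \<le> t"
proof (rule ccontr)
  assume "\<not> s \<le> t"
  then have "\<theta> * (t * drive s B) < \<theta> * (s * drive t B)"
    using assms drive_ratio_less[of t s B] by simp
  also have "\<dots> = s * t" using assms(2) by (simp add: algebra_simps)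
  also have "\<dots> \<le> \<theta> * (t * drive s B)" using assms by (simp add: algebra_simps)
  finally show False by simp
qed

lemma fixpt_exists:
  assumes "0 < \<theta>" "0 < B" shows "\<exists>t>0. t = \<theta> * drive t B"
proof -
  \<comment> \<open>\<open>drive\<close> never exceeds E[W], so \<open>?g\<close> is nonnegative at
    \<open>?b\<close>, while at 0 it equals -\<theta> E[W] tanh B < 0.\<close>
  let ?b = "\<theta> * EW M + 1"
  let ?g = "\<lambda>t. t - \<theta> * drive t B"
  have b: "0 < ?b" using assms mean_pos by (intro add_pos_pos mult_pos_pos) auto
  have g0: "?g 0 < 0"
  proof -
    have "drive 0 B = tanh B * EW M" by (simp add: drive_def EW_def mult.commute)
    then show ?thesis using assms mean_pos by simp
  qed
  have "\<exists>t\<ge>0. t \<le> ?b \<and> ?g t = 0"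
  proof (rule IVT'[where f = ?g])
    show "0 \<le> ?g ?b" using drive_le_mean[of ?b B] assms
      by (smt (verit) mult_left_mono)
    show "continuous_on {0..?b} ?g"
      unfolding continuous_on_def by (intro ballI tendsto_intros tendsto_drive)
  qed (use g0 b in auto)
  then obtain t where "0 \<le> t" "?g t = 0" by auto
  moreover have "t \<noteq> 0" using calculation g0 by auto
  ultimately show ?thesis by (intro exI[of _ t]) auto
qed

lemma fixpt_props:
  assumes "0 < \<theta>" "0 < B"
  shows fixpt_pos: "0 < fixpt \<theta> B" and fixpt_eq: "fixpt \<theta> B = \<theta> * drive (fixpt \<theta> B) B"
proof -
  obtain t where t: "0 < t" "t = \<theta> * drive t B" using fixpt_exists[OF assms] by auto
  have "fixpt \<theta> B = t"
    unfolding fixpt_def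
  proof (rule the_equality)
    fix s assume s: "0 < s \<and> s = \<theta> * drive s B"
    show "s = t" using fixpt_unique[of t \<theta> B s] fixpt_unique[of s \<theta> B t] s t assms by auto
  qed (use t in auto)
  then show "0 < fixpt \<theta> B" "fixpt \<theta> B = \<theta> * drive (fixpt \<theta> B) B" using t by auto
qed

lemma fixpt_eqI:
  assumes "0 < \<theta>" "0 < B" "0 < t" "t = \<theta> * drive t B" shows "t = fixpt \<theta> B"
  using fixpt_unique[of t \<theta> B "fixpt \<theta> B"] fixpt_unique[of "fixpt \<theta> B" \<theta> B t]
    fixpt_props[OF assms(1,2)] assms by auto

lemma le_fixpt:
  assumes "0 < \<theta>" "0 < B" "0 < s" "s \<le> \<theta> * drive s B" shows "s \<le> fixpt \<theta> B"
  using fixpt_unique[of "fixpt \<theta> B" \<theta> B s] fixpt_props[OF assms(1,2)] assms by auto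

lemma fixpt_mono:
  assumes "0 < \<theta>" "0 < B" "B \<le> B'" shows "fixpt \<theta> B \<le> fixpt \<theta> B'"
proof (rule le_fixpt)
  have "fixpt \<theta> B = \<theta> * drive (fixpt \<theta> B) B" by (rule fixpt_eq) (use assms in auto)
  also have "\<dots> \<le> \<theta> * drive (fixpt \<theta> B) B'" using assms by (intro mult_left_mono drive_mono) auto
  finally show "fixpt \<theta> B \<le> \<theta> * drive (fixpt \<theta> B) B'" .
qed (use assms fixpt_pos in auto)

text \<open>Together with monotonicity this makes the fixed point continuous in B, without compactness.\<close>

lemma fixpt_scale:
  assumes "0 < \<theta>" "0 < B" "B \<le> B'" shows "(B / B') * fixpt \<theta> B' \<le> fixpt \<theta> B"
proof (rule le_fixpt)
  let ?t = "fixpt \<theta> B'"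
  have t: "0 < ?t" using assms fixpt_pos by auto
  then show "0 < B / B' * ?t" using assms by simp
  have "B / B' * ?t = \<theta> * (B / B' * drive ?t B')"
    using fixpt_eq[of \<theta> B'] assms by (simp add: algebra_simps)
  also have "\<dots> \<le> \<theta> * drive (B / B' * ?t) (B / B' * B')"
    using assms t by (intro mult_left_mono drive_scale) auto
  finally show "B / B' * ?t \<le> \<theta> * drive (B / B' * ?t) B" using assms by simp
qed (use assms in auto)

text \<open>To the right of B monotonicity gives the lower bound and scaling the upper one; to the
  left they exchange roles. Taking min and max merges the two sides into one sandwich.\<close>

lemma isCont_fixpt:
  assumes "0 < \<theta>" "0 < B" shows "(fixpt \<theta> \<longlongrightarrow> fixpt \<theta> B) (at B)"
proof (rule tendsto_sandwich)
  have ev: "\<forall>\<^sub>F y in at B. 0 < y"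
    using assms(2) by (intro order_tendstoD[OF tendsto_ident_at])
  show "\<forall>\<^sub>F y in at B. min (fixpt \<theta> B) ((y / B) * fixpt \<theta> B) \<le> fixpt \<theta> y"
    using ev
  proof eventually_elim
    case (elim y)
    show ?case using fixpt_mono[of \<theta> B y] fixpt_scale[of \<theta> y B] elim assms
      by (cases "B \<le> y") (auto simp: min_le_iff_disj)
  qed
  show "\<forall>\<^sub>F y in at B. fixpt \<theta> y \<le> max (fixpt \<theta> B) ((y / B) * fixpt \<theta> B)"
    using ev
  proof eventually_elim
    case (elim y)
    show ?case using fixpt_mono[of \<theta> y B] fixpt_scale[of \<theta> B y] elim assms
      by (cases "B \<le> y") (auto simp: le_max_iff_disj field_simps)
  qed
  have "((\<lambda>y. min (fixpt \<theta> B) (y / B * fixpt \<theta> B)) \<longlongrightarrow> min (fixpt \<theta> B) (B / B * fixpt \<theta> B)) (at B)"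
    by (intro tendsto_intros) (use assms in auto)
  then show "((\<lambda>y. min (fixpt \<theta> B) (y / B * fixpt \<theta> B)) \<longlongrightarrow> fixpt \<theta> B) (at B)" using assms by simp
  have "((\<lambda>y. max (fixpt \<theta> B) (y / B * fixpt \<theta> B)) \<longlongrightarrow> max (fixpt \<theta> B) (B / B * fixpt \<theta> B)) (at B)"
    by (intro tendsto_intros) (use assms in auto)
  then show "((\<lambda>y. max (fixpt \<theta> B) (y / B * fixpt \<theta> B)) \<longlongrightarrow> fixpt \<theta> B) (at B)" using assms by simp
qed

end

section \<open>Differentiability and the zero-field limit\<close>

lemma tanh_defect_pos: "0 < s \<Longrightarrow> 0 < tanh_defect s"
proof -
  assume s: "0 < s"
  obtain c where c: "0 < c" "\<And>s. 0 \<le> s \<Longrightarrow> c * (min s 1) ^ 4 \<le> s * tanh_defect s"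
    using tanh_defect_lower by blast
  have "0 < c * (min s 1) ^ 4" using c s by simp
  also have "\<dots> \<le> s * tanh_defect s" using c s by simp
  finally show ?thesis using s by (simp add: zero_less_mult_iff)
qed

context weight_law begin

definition mag :: "real \<Rightarrow> real \<Rightarrow> real" where
  "mag \<theta> B = (\<integral>x. tanh (x * fixpt \<theta> B + B) \<partial>M)"

text \<open>Orders 2 and 1 are the partial derivatives of \<open>drive\<close> in t and in B; orders
  1 and 0 are those of E[tanh (W t + B)]. Two moments of W suffice for all of them.\<close>

definition sech_moment :: "nat \<Rightarrow> real \<Rightarrow> real \<Rightarrow> real" where
  "sech_moment i t B = (\<integral>x. x ^ i * (1 - tanh (x * t + B) ^ 2) \<partial>M)"

lemma integrable_power: "i \<le> 2 \<Longrightarrow> integrable M (\<lambda>x. x ^ i)"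
  using integrable_sq integrable_id by (auto simp: numeral_2_eq_2 le_Suc_eq)

lemma abs_sech_sq_le_one: "\<bar>1 - tanh x ^ 2\<bar> \<le> (1::real)"
  using tanh_sq_le_one[of x] by (simp add: abs_le_iff)

lemma integrable_sech_moment: "i \<le> 2 \<Longrightarrow> integrable M (\<lambda>x. x ^ i * (1 - tanh (x * t + B) ^ 2))"
  by (rule integrable_times_bounded[OF integrable_power]) (auto intro: abs_sech_sq_le_one)

lemma tendsto_sech_moment:
  fixes t B :: "real \<Rightarrow> real"
  assumes "(t \<longlongrightarrow> t0) (at a within S)" "(B \<longlongrightarrow> B0) (at a within S)" "i \<le> 2"
  shows "((\<lambda>y. sech_moment i (t y) (B y)) \<longlongrightarrow> sech_moment i t0 B0) (at a within S)"
  unfolding sech_moment_def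
  by (rule tendsto_expectation[OF assms(1,2) integrable_power[OF assms(3)], where \<psi> = "\<lambda>x. 1 - tanh x ^ 2"])
     (auto intro!: continuous_intros abs_sech_sq_le_one)

lemma sech_moment_zero:
  "sech_moment 0 0 0 = 1" "sech_moment 1 0 0 = EW M" "sech_moment 2 0 0 = second_moment"
  by (simp_all add: sech_moment_def EW_def second_moment_def prob_space[simplified])

text \<open>\<open>gap_mean\<close> is the D of the overview, and \<open>defect_mean\<close> is its
  E[W k(W t)].\<close>

definition gap_mean :: "real \<Rightarrow> real" where
  "gap_mean t = (\<integral>x. x * tanh_gap (x * t) \<partial>M)"

definition defect_mean :: "real \<Rightarrow> real" where
  "defect_mean t = (\<integral>x. x * tanh_defect (x * t) \<partial>M)"

lemma gap_mean_eq: "gap_mean t = t * second_moment - drive t 0"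
proof -
  have "gap_mean t = (\<integral>x. t * x\<^sup>2 - x * tanh (x * t + 0) \<partial>M)"
    by (simp add: gap_mean_def tanh_gap_def algebra_simps power2_eq_square)
  also have "\<dots> = t * second_moment - drive t 0"
    unfolding drive_def second_moment_def
    by (subst Bochner_Integration.integral_diff) (auto intro!: integrable_sq integrable_drive[of t 0, simplified])
  finally show ?thesis .
qed

text \<open>The fixed-point equation allows the 1 to be written as \<theta> drive t B / t, which
  turns the difference into a single expectation whose integrand has a sign.\<close>

lemma one_minus_sech_eq:
  assumes "0 < t" "t = \<theta> * drive t B"
  shows "1 - \<theta> * sech_moment 2 t B =
    (\<theta> / t) * (\<integral>x. x * (tanh (x * t + B) - x * t * (1 - tanh (x * t + B) ^ 2)) \<partial>M)"
proof -
  have "(\<integral>x. x * (tanh (x * t + B) - x * t * (1 - tanh (x * t + B) ^ 2)) \<partial>M) =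
    (\<integral>x. x * tanh (x * t + B) - t * (x ^ 2 * (1 - tanh (x * t + B) ^ 2)) \<partial>M)"
    by (simp add: algebra_simps power2_eq_square)
  also have "\<dots> = drive t B - t * sech_moment 2 t B"
    unfolding drive_def sech_moment_def
    by (subst Bochner_Integration.integral_diff)
       (auto intro!: integrable_sech_moment integrable_drive simp del: mult_minus_right)
  finally have I: "(\<integral>x. x * (tanh (x * t + B) - x * t * (1 - tanh (x * t + B) ^ 2)) \<partial>M) =
    drive t B - t * sech_moment 2 t B" .
  show ?thesis unfolding I using assms by (simp add: field_simps)
qed

lemma one_minus_sech_defect:
  assumes "0 < t" "t = \<theta> * drive t 0"
  shows "1 - \<theta> * sech_moment 2 t 0 = (\<theta> / t) * defect_mean t"
  using one_minus_sech_eq[OF assms] by (simp add: defect_mean_def tanh_defect_def)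

text \<open>With u = x t + B, the bracket splits as \<open>tanh_defect u\<close> plus B sech^2 u. So
  the susceptibility denominator is positive at every positive fixed point, also in zero
  field.\<close>

lemma one_minus_sech_pos:
  assumes "0 < t" "t = \<theta> * drive t B" "0 \<le> B" "0 < \<theta>"
  shows "0 < 1 - \<theta> * sech_moment 2 t B"
  unfolding one_minus_sech_eq[OF assms(1,2)]
proof (rule mult_pos_pos[OF _ expectation_pos])
  have "integrable M (\<lambda>x. x * tanh (x * t + B) - t * (x ^ 2 * (1 - tanh (x * t + B) ^ 2)))"
    by (intro Bochner_Integration.integrable_diff integrable_drive integrable_mult_right integrable_sech_moment) simp
  then show "integrable M (\<lambda>x. x * (tanh (x * t + B) - x * t * (1 - tanh (x * t + B) ^ 2)))"
    by (simp add: algebra_simps power2_eq_square)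
  show "0 < x * (tanh (x * t + B) - x * t * (1 - tanh (x * t + B) ^ 2))" if x: "0 < x" for x
  proof (intro mult_pos_pos x)
    have "0 < tanh_defect (x * t + B)"
      using x assms by (intro tanh_defect_pos add_pos_nonneg mult_pos_pos) auto
    moreover have "0 \<le> B * (1 - tanh (x * t + B) ^ 2)"
      using assms tanh_sq_le_one by (intro mult_nonneg_nonneg) auto
    ultimately show "0 < tanh (x * t + B) - x * t * (1 - tanh (x * t + B) ^ 2)"
      by (simp add: tanh_defect_def algebra_simps)
  qed
qed (use assms in auto)

text \<open>
  Caratheodory slopes turn the implicit equation into exact linear identities for finite increments,
  so that dominated convergence replaces the implicit function theorem.
\<close>

definition slope_moment :: "real \<Rightarrow> real \<Rightarrow> nat \<Rightarrow> real \<Rightarrow> real" where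
  "slope_moment \<theta> B i y =
    (\<integral>x. x ^ i * tanh_slope (x * fixpt \<theta> B + B) (x * fixpt \<theta> y + y) \<partial>M)"

lemma integrable_slope_moment:
  "i \<le> 2 \<Longrightarrow> integrable M (\<lambda>x. x ^ i * tanh_slope (x * fixpt \<theta> B + B) (x * fixpt \<theta> y + y))"
  by (rule integrable_times_bounded[OF integrable_power]) (auto intro: abs_tanh_slope_le)

lemma tendsto_slope_moment:
  assumes "0 < \<theta>" "0 < B" "i \<le> 2"
  shows "(slope_moment \<theta> B i \<longlongrightarrow> sech_moment i (fixpt \<theta> B) B) (at B)"
  unfolding slope_moment_def sech_moment_def
proof (rule integral_dominated_tendsto_at[where w = "\<lambda>x. \<bar>x ^ i\<bar>"])
  let ?t = "fixpt \<theta> B"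
  show "((\<lambda>y. x ^ i * tanh_slope (x * ?t + B) (x * fixpt \<theta> y + y)) \<longlongrightarrow>
      x ^ i * (1 - tanh (x * ?t + B) ^ 2)) (at B)" for x
  proof (rule tendsto_mult_left)
    have "((\<lambda>y. tanh_slope (x * ?t + B) (x * fixpt \<theta> y + y)) \<longlongrightarrow>
        tanh_slope (x * ?t + B) (x * ?t + B)) (at B)"
      by (intro isCont_tendsto_compose[OF isCont_tanh_slope] tendsto_intros isCont_fixpt assms)
    then show "((\<lambda>y. tanh_slope (x * ?t + B) (x * fixpt \<theta> y + y)) \<longlongrightarrow> 1 - tanh (x * ?t + B) ^ 2) (at B)"
      by (simp add: tanh_slope_def)
  qed
  show "\<bar>x ^ i * tanh_slope (x * ?t + B) (x * fixpt \<theta> y + y)\<bar> \<le> \<bar>x ^ i\<bar>" for x y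
    using abs_tanh_slope_le by (simp add: abs_mult mult_left_le)
qed (use integrable_power[OF assms(3)] in auto)

text \<open>The increment of x t + B is x times the increment of t plus the increment of B. Weighted
  by x and the slope, the two parts contribute slope moments of order 2 and 1, and the resulting
  equation is linear in the increment of the fixed point.\<close>

lemma fixpt_increment:
  assumes "0 < \<theta>" "0 < B" "0 < y"
  shows "(fixpt \<theta> y - fixpt \<theta> B) * (1 - \<theta> * slope_moment \<theta> B 2 y) = (y - B) * (\<theta> * slope_moment \<theta> B 1 y)"
proof -
  let ?t = "fixpt \<theta> B" and ?s = "fixpt \<theta> y"
  let ?q = "\<lambda>x. tanh_slope (x * ?t + B) (x * ?s + y)"
  have "?s - ?t = \<theta> * (drive ?s y - drive ?t B)"
    using fixpt_eq[of \<theta> B] fixpt_eq[of \<theta> y] assms by (simp add: algebra_simps)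
  also have "drive ?s y - drive ?t B = (\<integral>x. x * tanh (x * ?s + y) - x * tanh (x * ?t + B) \<partial>M)"
    using integrable_drive by (simp add: drive_def)
  also have "\<dots> = (\<integral>x. (?s - ?t) * (x ^ 2 * ?q x) + (y - B) * (x ^ 1 * ?q x) \<partial>M)"
  proof (rule Bochner_Integration.integral_cong)
    fix x
    have "x * tanh (x * ?s + y) - x * tanh (x * ?t + B) = x * (?q x * ((x * ?s + y) - (x * ?t + B)))"
      unfolding tanh_slope_mult[symmetric] by (rule right_diff_distrib[symmetric])
    then show "x * tanh (x * ?s + y) - x * tanh (x * ?t + B) =
        (?s - ?t) * (x ^ 2 * ?q x) + (y - B) * (x ^ 1 * ?q x)"
      by (simp add: algebra_simps power2_eq_square)
  qed simp
  also have "\<dots> = (?s - ?t) * slope_moment \<theta> B 2 y + (y - B) * slope_moment \<theta> B 1 y"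
    unfolding slope_moment_def
    by (subst Bochner_Integration.integral_add)
       (auto intro!: integrable_slope_moment[of 2] integrable_slope_moment[of 1, simplified])
  finally show ?thesis by (simp add: algebra_simps)
qed

lemma integrable_tanh: "integrable M (\<lambda>x. tanh (x * t + B))"
  using integrable_times_bounded[of "\<lambda>_. 1" "\<lambda>x. tanh (x * t + B)" 1] tanh_abs_le_one by simp

lemma mag_increment:
  "mag \<theta> y - mag \<theta> B = (fixpt \<theta> y - fixpt \<theta> B) * slope_moment \<theta> B 1 y + (y - B) * slope_moment \<theta> B 0 y"
proof -
  let ?t = "fixpt \<theta> B" and ?s = "fixpt \<theta> y"
  let ?q = "\<lambda>x. tanh_slope (x * ?t + B) (x * ?s + y)"
  have "mag \<theta> y - mag \<theta> B = (\<integral>x. tanh (x * ?s + y) - tanh (x * ?t + B) \<partial>M)"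
    using integrable_tanh by (simp add: mag_def)
  also have "\<dots> = (\<integral>x. (?s - ?t) * (x ^ 1 * ?q x) + (y - B) * (x ^ 0 * ?q x) \<partial>M)"
  proof (rule Bochner_Integration.integral_cong)
    fix x
    show "tanh (x * ?s + y) - tanh (x * ?t + B) =
        (?s - ?t) * (x ^ 1 * ?q x) + (y - B) * (x ^ 0 * ?q x)"
      unfolding tanh_slope_mult[of "x * ?s + y" "x * ?t + B"] by (simp add: algebra_simps)
  qed simp
  also have "\<dots> = (?s - ?t) * slope_moment \<theta> B 1 y + (y - B) * slope_moment \<theta> B 0 y"
    unfolding slope_moment_def
    by (subst Bochner_Integration.integral_add)
       (auto intro!: integrable_slope_moment[of 0, simplified] integrable_slope_moment[of 1, simplified])
  finally show ?thesis .
qed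

text \<open>Here t is a free argument, so that the same formula serves at \<open>fixpt\<close> for
  positive fields and at \<open>fixpt0\<close> in the zero-field limit.\<close>

definition susc :: "real \<Rightarrow> real \<Rightarrow> real \<Rightarrow> real" where
  "susc \<theta> t B = sech_moment 0 t B + \<theta> * (sech_moment 1 t B)\<^sup>2 / (1 - \<theta> * sech_moment 2 t B)"

lemma DERIV_mag:
  assumes "0 < \<theta>" "0 < B"
  shows "(mag \<theta> has_real_derivative susc \<theta> (fixpt \<theta> B) B) (at B)"
  unfolding has_field_derivative_iff
proof (rule Lim_transform_eventually)
  let ?t = "fixpt \<theta> B"
  let ?A = "slope_moment \<theta> B"
  have pos: "0 < 1 - \<theta> * sech_moment 2 ?t B"
    using assms fixpt_pos fixpt_eq by (intro one_minus_sech_pos) auto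
  have lim: "((\<lambda>y. 1 - \<theta> * ?A 2 y) \<longlongrightarrow> 1 - \<theta> * sech_moment 2 ?t B) (at B)"
    by (intro tendsto_intros tendsto_slope_moment assms) simp
  show "((\<lambda>y. ?A 0 y + \<theta> * (?A 1 y)\<^sup>2 / (1 - \<theta> * ?A 2 y)) \<longlongrightarrow> susc \<theta> ?t B) (at B)"
    unfolding susc_def
    by (intro tendsto_intros tendsto_slope_moment assms) (use pos in auto)
  \<comment> \<open>The fixed-point equation is known for positive fields only, and solving for the
    increment needs a nonvanishing denominator; both hold near B.\<close>
  have "\<forall>\<^sub>F y in at B. 0 < y"
    using assms(2) by (intro order_tendstoD[OF tendsto_ident_at])
  moreover have "\<forall>\<^sub>F y in at B. 0 < 1 - \<theta> * ?A 2 y"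
    by (rule order_tendstoD(1)[OF lim pos])
  moreover have "\<forall>\<^sub>F y in at B. y \<noteq> B" by (simp add: eventually_at_filter)
  ultimately show "\<forall>\<^sub>F y in at B. ?A 0 y + \<theta> * (?A 1 y)\<^sup>2 / (1 - \<theta> * ?A 2 y) = (mag \<theta> y - mag \<theta> B) / (y - B)"
  proof eventually_elim
    case (elim y)
    have d: "fixpt \<theta> y - ?t = (y - B) * (\<theta> * ?A 1 y) / (1 - \<theta> * ?A 2 y)"
      using fixpt_increment[OF assms elim(1)] elim(2) by (simp add: eq_divide_eq)
    have "mag \<theta> y - mag \<theta> B = (y - B) * (?A 0 y + \<theta> * (?A 1 y)\<^sup>2 / (1 - \<theta> * ?A 2 y))"
      unfolding mag_increment d by (simp add: algebra_simps power2_eq_square)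
    then show ?case using elim by simp
  qed
qed

section \<open>The zero-field limit of the fixed point\<close>

definition fixpt0 :: "real \<Rightarrow> real" where
  "fixpt0 \<theta> = Inf (fixpt \<theta> ` {0<..})"

lemma fixpt0_nonneg: "0 < \<theta> \<Longrightarrow> 0 \<le> fixpt0 \<theta>"
  unfolding fixpt0_def by (rule cInf_greatest) (auto intro: less_imp_le fixpt_pos)

lemma fixpt0_le: "0 < \<theta> \<Longrightarrow> 0 < B \<Longrightarrow> fixpt0 \<theta> \<le> fixpt \<theta> B"
  unfolding fixpt0_def
  by (intro cInf_lower bdd_belowI[of _ 0]) (auto intro: less_imp_le fixpt_pos)

text \<open>Monotonicity in B makes the infimum a right-hand limit, so its existence is
  automatic.\<close>

lemma tendsto_fixpt0:
  assumes "0 < \<theta>" shows "(fixpt \<theta> \<longlongrightarrow> fixpt0 \<theta>) (at_right 0)"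
proof (rule order_tendstoI)
  fix a assume a: "a < fixpt0 \<theta>"
  show "\<forall>\<^sub>F B in at_right 0. a < fixpt \<theta> B"
    using eventually_at_right_less[of 0]
    by eventually_elim (use a fixpt0_le[OF assms] in \<open>auto intro: less_le_trans\<close>)
next
  fix a assume "fixpt0 \<theta> < a"
  then obtain B where B: "0 < B" "fixpt \<theta> B < a"
    unfolding fixpt0_def by (subst (asm) cInf_less_iff)
      (auto intro!: bdd_belowI[of _ 0] less_imp_le fixpt_pos assms)
  have "\<forall>\<^sub>F y in at_right 0. 0 < y \<and> y < B"
    using B by (auto simp: eventually_at_right_field)
  then show "\<forall>\<^sub>F y in at_right 0. fixpt \<theta> y < a"
    by eventually_elim (use fixpt_mono[OF assms] B in \<open>auto intro: le_less_trans less_imp_le\<close>)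
qed

lemma fixpt0_eq:
  assumes "0 < \<theta>" shows "fixpt0 \<theta> = \<theta> * drive (fixpt0 \<theta>) 0"
proof (rule tendsto_unique[OF _ tendsto_fixpt0[OF assms]])
  have "((\<lambda>B. \<theta> * drive (fixpt \<theta> B) B) \<longlongrightarrow> \<theta> * drive (fixpt0 \<theta>) 0) (at_right 0)"
    by (intro tendsto_intros tendsto_drive tendsto_fixpt0 assms)
  then show "(fixpt \<theta> \<longlongrightarrow> \<theta> * drive (fixpt0 \<theta>) 0) (at_right 0)"
    by (rule Lim_transform_eventually)
       (use eventually_at_right_less[of 0] in eventually_elim, use fixpt_eq[OF assms] in auto)
qed simp

lemma integrable_gap: "integrable M (\<lambda>x. x * tanh_gap (x * t))"
proof -
  have "integrable M (\<lambda>x. t * x\<^sup>2 - x * tanh (x * t + 0))"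
    by (intro Bochner_Integration.integrable_diff integrable_drive integrable_mult_right integrable_sq)
  then show ?thesis by (simp add: tanh_gap_def algebra_simps power2_eq_square)
qed

lemma gap_mean_pos:
  assumes "0 < t" shows "0 < gap_mean t"
  unfolding gap_mean_def
proof (rule expectation_pos[OF integrable_gap])
  show "0 < x * tanh_gap (x * t)" if "0 < x" for x
    using that assms tanh_defect_pos[of "x * t"] tanh_defect_le_gap[of "x * t"] by (simp)
qed simp

text \<open>The quotient is E[W^2] - drive t 0 / t, and the subtracted term is
  nonincreasing.\<close>

lemma gap_mean_ratio_mono:
  assumes "0 < s" "s \<le> t" shows "gap_mean s / s \<le> gap_mean t / t"
  using drive_ratio_le[OF assms, of 0] assms
  by (simp add: gap_mean_eq field_simps)

lemma gap_mean_fixpt0: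
  assumes "0 < \<theta>" "0 < fixpt0 \<theta>"
  shows "gap_mean (fixpt0 \<theta>) / fixpt0 \<theta> = second_moment - 1 / \<theta>"
  using fixpt0_eq[OF assms(1)] assms by (simp add: gap_mean_eq field_simps)

text \<open>A positive zero-field solution would force D(t)/t = E[W^2] - 1/\<theta> \<le> 0, against
  D(t) > 0.\<close>

lemma fixpt0_zero:
  assumes "0 < \<theta>" "\<theta> * second_moment \<le> 1" shows "fixpt0 \<theta> = 0"
proof (rule ccontr)
  assume "fixpt0 \<theta> \<noteq> 0"
  then have p: "0 < fixpt0 \<theta>" using fixpt0_nonneg[OF assms(1)] by simp
  have "0 < gap_mean (fixpt0 \<theta>) / fixpt0 \<theta>" using gap_mean_pos p by simp
  then show False using gap_mean_fixpt0[OF assms(1) p] assms by (simp add: field_simps)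
qed

text \<open>Some small s is a subsolution in zero field, hence in every positive field. It bounds
  all fixed points from below uniformly in B, and so their infimum.\<close>

lemma fixpt0_pos:
  assumes "0 < \<theta>" "1 < \<theta> * second_moment" shows "0 < fixpt0 \<theta>"
proof -
  have "((\<lambda>s. \<theta> * sech_moment 2 s 0) \<longlongrightarrow> \<theta> * sech_moment 2 0 0) (at_right 0)"
    by (intro tendsto_intros tendsto_sech_moment) auto
  then have "\<forall>\<^sub>F s in at_right 0. 1 < \<theta> * sech_moment 2 s 0"
    by (rule order_tendstoD) (use assms in \<open>simp add: sech_moment_zero\<close>)
  then have "\<forall>\<^sub>F s in at_right 0. 1 < \<theta> * sech_moment 2 s 0 \<and> 0 < s"
    using eventually_at_right_less[of 0] by eventually_elim auto
  then obtain s where s: "1 < \<theta> * sech_moment 2 s 0" "0 < s"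
    using eventually_happens' trivial_limit_at_right_real by blast
  \<comment> \<open>This is tanh u \<ge> u sech^2 u at u = x s, multiplied by x and
    averaged.\<close>
  have "s * sech_moment 2 s 0 \<le> drive s 0"
  proof -
    have "(\<integral>x. s * (x ^ 2 * (1 - tanh (x * s + 0) ^ 2)) \<partial>M) \<le> drive s 0"
      unfolding drive_def
    proof (rule integral_mono_AE[OF integrable_mult_right[OF integrable_sech_moment] integrable_drive])
      show "AE x in M. s * (x ^ 2 * (1 - tanh (x * s + 0) ^ 2)) \<le> x * tanh (x * s + 0)"
        using nonneg
      proof eventually_elim
        case (elim x)
        from mult_left_mono[OF tanh_defect_nonneg[of "x * s"] elim] show ?case
          using elim s by (simp add: tanh_defect_def algebra_simps power2_eq_square)
      qed
    qed simp
    then show ?thesis by (simp add: sech_moment_def)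
  qed
  then have "s \<le> \<theta> * drive s 0"
    using s assms
    by (smt (verit) mult.left_commute mult_left_mono mult_le_cancel_left1)
  then have "s \<le> fixpt \<theta> B" if "0 < B" for B
    using s assms that drive_mono[of s s 0 B]
    by (intro le_fixpt) (auto intro: order_trans)
  then have "s \<le> fixpt0 \<theta>"
    unfolding fixpt0_def by (intro cInf_greatest) auto
  then show ?thesis using s by simp
qed

lemma tendsto_mag0:
  assumes "0 < \<theta>" shows "(mag \<theta> \<longlongrightarrow> (\<integral>x. tanh (x * fixpt0 \<theta>) \<partial>M)) (at_right 0)"
  using tendsto_expectation[OF tendsto_fixpt0[OF assms] tendsto_ident_at, of "\<lambda>_. 1" tanh]
  by (simp add: mag_def[abs_def] tanh_abs_le_one continuous_intros)

text \<open>Off criticality the denominator of \<open>susc\<close> stays positive in the limit: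
  below, the fixed point is 0 and the denominator is 1 - \<theta> E[W^2]; above, the limit is a
  positive zero-field solution and \<open>one_minus_sech_pos\<close> applies.\<close>

lemma tendsto_deriv_mag:
  assumes "0 < \<theta>" "\<theta> * second_moment \<noteq> 1"
  shows "((\<lambda>B. deriv (mag \<theta>) B) \<longlongrightarrow> susc \<theta> (fixpt0 \<theta>) 0) (at_right 0)"
proof (rule Lim_transform_eventually)
  have pos: "0 < 1 - \<theta> * sech_moment 2 (fixpt0 \<theta>) 0"
  proof (cases "\<theta> * second_moment < 1")
    case True
    then show ?thesis using fixpt0_zero[OF assms(1)] by (simp add: sech_moment_zero)
  next
    case False
    then show ?thesis
      using assms by (intro one_minus_sech_pos fixpt0_pos fixpt0_eq) auto
  qed
  show "((\<lambda>B. susc \<theta> (fixpt \<theta> B) B) \<longlongrightarrow> susc \<theta> (fixpt0 \<theta>) 0) (at_right 0)"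
    unfolding susc_def
    by (intro tendsto_intros tendsto_sech_moment tendsto_fixpt0 assms) (use pos in auto)
  show "\<forall>\<^sub>F B in at_right 0. susc \<theta> (fixpt \<theta> B) B = deriv (mag \<theta>) B"
    using eventually_at_right_less[of 0]
    by eventually_elim (use DERIV_mag[OF assms(1)] DERIV_imp_deriv in metis)
qed

end

section \<open>Asymptotics near criticality\<close>

lemma bigtheta_sandwich:
  fixes f g :: "'a \<Rightarrow> real"
  assumes "0 < c" "\<forall>\<^sub>F x in F. 0 \<le> g x \<and> c * g x \<le> f x \<and> f x \<le> C * g x"
  shows "f \<in> \<Theta>[F](g)"
\<comment> \<open>The upper constant must be positive, whereas nothing is assumed about C.\<close>
proof (rule bigthetaI'[OF \<open>0 < c\<close>, of "max C 1"])
  show "\<forall>\<^sub>F x in F. c * norm (g x) \<le> norm (f x) \<and> norm (f x) \<le> max C 1 * norm (g x)"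
    using assms(2)
  proof eventually_elim
    case (elim x)
    have "0 \<le> c * g x" using elim assms(1) by simp
    moreover have "C * g x \<le> max C 1 * g x" using elim by (intro mult_right_mono) auto
    ultimately show ?case using elim by simp
  qed
qed simp

lemma tendsto_imp_bigtheta_one:
  fixes f :: "'a \<Rightarrow> real"
  assumes "(f \<longlongrightarrow> c) F" "c \<noteq> 0" shows "f \<in> \<Theta>[F](\<lambda>_. 1)"
  using assms by (intro bigthetaI_tendsto[of c]) auto

lemma bigtheta_quotient:
  fixes f1 f2 g1 g2 :: "'a \<Rightarrow> real"
  assumes "f1 \<in> \<Theta>[F](g1)" "f2 \<in> \<Theta>[F](g2)"
  shows "(\<lambda>x. f1 x / f2 x) \<in> \<Theta>[F](\<lambda>x. g1 x / g2 x)"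
  unfolding divide_inverse using assms by (intro landau_theta.mult) simp_all

lemma bigtheta_inverse_powr:
  fixes t e :: "'a \<Rightarrow> real"
  assumes "(\<lambda>x. t x powr q) \<in> \<Theta>[F](e)" "0 < q" "\<forall>\<^sub>F x in F. 0 < t x" "\<forall>\<^sub>F x in F. 0 < e x"
  shows "t \<in> \<Theta>[F](\<lambda>x. e x powr (1 / q))"
proof -
  have "t \<in> \<Theta>[F](\<lambda>x. \<bar>t x powr q\<bar> powr (1 / q))"
    by (rule bigthetaI_cong) (use assms(3) in eventually_elim, use assms(2) in \<open>simp add: powr_powr\<close>)
  also have "(\<lambda>x. \<bar>t x powr q\<bar> powr (1 / q)) \<in> \<Theta>[F](\<lambda>x. \<bar>e x\<bar> powr (1 / q))"
    by (rule bigtheta_powr[OF assms(1)])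
  also have "(\<lambda>x. \<bar>e x\<bar> powr (1 / q)) \<in> \<Theta>[F](\<lambda>x. e x powr (1 / q))"
    by (rule bigthetaI_cong) (use assms(4) in eventually_elim, simp)
  finally show ?thesis .
qed

text \<open>Taking logarithms of the relation gives ln (1/e) ~ q ln (1/t), because ln ln (1/t) is of
  lower order. So ln (1/t) may be traded for ln (1/e) up to constants, and the pure power case
  finishes.\<close>

lemma bigtheta_inverse_powr_log:
  fixes t e :: "'a \<Rightarrow> real"
  assumes \<Theta>: "(\<lambda>x. t x powr q * ln (1 / t x)) \<in> \<Theta>[F](e)" and q: "0 < q"
    and t: "filterlim t (at_right 0) F" and e: "\<forall>\<^sub>F x in F. 0 < e x"
  shows "t \<in> \<Theta>[F](\<lambda>x. (e x / ln (1 / e x)) powr (1 / q))"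
proof -
  define L where "L x = ln (1 / t x)" for x
  have tpos: "\<forall>\<^sub>F x in F. 0 < t x"
    using t eventually_at_right_less[of 0] unfolding filterlim_iff by blast
  have "filterlim (\<lambda>x. inverse (t x)) at_top F"
    using filterlim_compose[OF filterlim_inverse_at_top_right t] .
  then have L: "filterlim L at_top F"
    unfolding L_def[abs_def] by (auto intro: filterlim_compose[OF ln_at_top] simp: inverse_eq_divide)
  have Lpos: "\<forall>\<^sub>F x in F. 0 < L x" using L by (simp add: filterlim_at_top_dense)
  obtain c C where c: "0 < c" "0 < C"
    and bnd: "\<forall>\<^sub>F x in F. c * norm (e x) \<le> norm (t x powr q * ln (1 / t x))"
      "\<forall>\<^sub>F x in F. norm (t x powr q * ln (1 / t x)) \<le> C * norm (e x)"
    using \<Theta> unfolding bigtheta_def by (auto elim!: landau_o.bigE landau_omega.bigE)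
  \<comment> \<open>With d = c and d = C these are the lower and upper bounds on ln (1/e) / L
    obtained from c e \<le> t^q L \<le> C e.\<close>
  have lim: "((\<lambda>x. (ln d + q * L x - ln (L x)) / L x) \<longlongrightarrow> q) F" for d
  proof -
    have "((\<lambda>x. ln d * inverse (L x) + q - ln (L x) / L x) \<longlongrightarrow> ln d * 0 + q - 0) F"
      by (intro tendsto_intros filterlim_compose[OF ln_x_over_x_tendsto_0 L]
            filterlim_compose[OF tendsto_inverse_0_at_top filterlim_ident]
            filterlim_compose[OF tendsto_inverse_0_at_top[OF filterlim_ident] L])
    then have "((\<lambda>x. ln d * inverse (L x) + q - ln (L x) / L x) \<longlongrightarrow> q) F" by simp
    then show ?thesis
      by (rule Lim_transform_eventually)
         (use Lpos in eventually_elim, simp add: field_simps)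
  qed
  have "((\<lambda>x. ln (1 / e x) / L x) \<longlongrightarrow> q) F"
  proof (rule tendsto_sandwich[OF _ _ lim[of c] lim[of C]])
    have key: "\<forall>\<^sub>F x in F. ln c + q * L x - ln (L x) \<le> ln (1 / e x) \<and> ln (1 / e x) \<le> ln C + q * L x - ln (L x)"
      using bnd e tpos Lpos
    proof eventually_elim
      case (elim x)
      have ln_main: "ln (t x powr q * L x) = - q * L x + ln (L x)"
      proof -
        have "ln (t x) = - L x" using elim(4) by (simp add: L_def ln_div)
        then show ?thesis using elim(4,5) by (simp add: ln_mult)
      qed
      have "c * e x \<le> t x powr q * L x" "t x powr q * L x \<le> C * e x"
        using elim by (simp_all add: L_def abs_mult)
      then have "ln (c * e x) \<le> ln (t x powr q * L x)" "ln (t x powr q * L x) \<le> ln (C * e x)"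
        using elim c by (auto intro!: ln_mono)
      then show ?case unfolding ln_main using elim c by (auto simp: ln_mult ln_div)
    qed
    show "\<forall>\<^sub>F x in F. (ln c + q * L x - ln (L x)) / L x \<le> ln (1 / e x) / L x"
      using key Lpos by eventually_elim (auto intro!: divide_right_mono)
    show "\<forall>\<^sub>F x in F. ln (1 / e x) / L x \<le> (ln C + q * L x - ln (L x)) / L x"
      using key Lpos by eventually_elim (auto intro!: divide_right_mono)
  qed
  then have log: "(\<lambda>x. ln (1 / e x)) \<in> \<Theta>[F](L)" and ratio: "((\<lambda>x. ln (1 / e x) / L x) \<longlongrightarrow> q) F"
    using q by (auto intro!: bigthetaI_tendsto[of q])
  have "\<forall>\<^sub>F x in F. 0 < ln (1 / e x) / L x" by (rule order_tendstoD(1)[OF ratio q])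
  then have lepos: "\<forall>\<^sub>F x in F. 0 < ln (1 / e x)"
    using Lpos by eventually_elim (simp add: zero_less_divide_iff)
  have "(\<lambda>x. t x powr q) \<in> \<Theta>[F](\<lambda>x. (t x powr q * L x) / L x)"
    by (rule bigthetaI_cong) (use Lpos in eventually_elim, simp)
  also have "(\<lambda>x. (t x powr q * L x) / L x) \<in> \<Theta>[F](\<lambda>x. e x / ln (1 / e x))"
    using \<Theta> log unfolding L_def[symmetric] by (intro bigtheta_quotient) (auto simp: bigtheta_sym)
  finally show ?thesis
    by (rule bigtheta_inverse_powr[OF _ q tpos])
       (use e lepos in eventually_elim, simp)
qed

context weight_law begin

section \<open>Magnetization and susceptibility in terms of the fixed point\<close>

lemma expectation_tanh_upper:
  assumes "0 \<le> t" "0 \<le> B" shows "(\<integral>x. tanh (x * t + B) \<partial>M) \<le> t * EW M + B"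
proof -
  have "(\<integral>x. tanh (x * t + B) \<partial>M) \<le> (\<integral>x. t * x + B \<partial>M)"
  proof (rule integral_mono_AE[OF integrable_tanh])
    show "AE x in M. tanh (x * t + B) \<le> t * x + B"
      using nonneg
    proof eventually_elim
      case (elim x)
      then show ?case using tanh_le_self[of "x * t + B"] assms by (simp add: mult.commute)
    qed
  qed (simp add: integrable_id)
  then show ?thesis using integrable_id by (simp add: EW_def prob_space[simplified])
qed

lemma expectation_tanh_lower:
  assumes "0 \<le> t" "0 \<le> B" shows "t * sech_moment 1 t 0 \<le> (\<integral>x. tanh (x * t + B) \<partial>M)"
proof -
  have "(\<integral>x. t * (x ^ 1 * (1 - tanh (x * t + 0) ^ 2)) \<partial>M) \<le> (\<integral>x. tanh (x * t + B) \<partial>M)"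
  proof (rule integral_mono_AE[OF integrable_mult_right[OF integrable_sech_moment] integrable_tanh])
    show "AE x in M. t * (x ^ 1 * (1 - tanh (x * t + 0) ^ 2)) \<le> tanh (x * t + B)"
      using nonneg
    proof eventually_elim
      case (elim x)
      have "tanh (x * t) \<le> tanh (x * t + B)" using assms by simp
      moreover have "t * (x * (1 - tanh (x * t) ^ 2)) \<le> tanh (x * t)"
        using tanh_defect_nonneg[of "x * t"] elim assms by (simp add: tanh_defect_def mult_ac)
      ultimately have "t * (x * (1 - tanh (x * t) ^ 2)) \<le> tanh (x * t + B)" by linarith
      then show ?case by simp
    qed
  qed simp
  then show ?thesis by (simp add: sech_moment_def)
qed

text \<open>The expectation lies between t E[W sech^2 (W t)] and t E[W] + B. As t tends to 0 the
  first factor approaches E[W] > 0, so the magnetization is of order t as long as B = O(t).\<close>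

lemma expectation_tanh_bigtheta:
  fixes t B :: "real \<Rightarrow> real"
  assumes t: "filterlim t (at_right 0) (at a within S)"
    and B: "\<forall>\<^sub>F y in at a within S. 0 \<le> B y \<and> B y \<le> C * t y"
  shows "(\<lambda>y. \<integral>x. tanh (x * t y + B y) \<partial>M) \<in> \<Theta>[at a within S](t)"
proof (rule bigtheta_sandwich)
  have lim: "((\<lambda>y. sech_moment 1 (t y) 0) \<longlongrightarrow> sech_moment 1 0 0) (at a within S)"
    using t by (intro tendsto_sech_moment) (auto simp: filterlim_at)
  have "\<forall>\<^sub>F y in at a within S. EW M / 2 < sech_moment 1 (t y) 0"
    by (rule order_tendstoD(1)[OF lim]) (use mean_pos in \<open>simp add: sech_moment_zero[simplified]\<close>)
  moreover have "\<forall>\<^sub>F y in at a within S. 0 < t y"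
    using t eventually_at_right_less[of 0] unfolding filterlim_iff by blast
  ultimately show "\<forall>\<^sub>F y in at a within S. 0 \<le> t y \<and> EW M / 2 * t y \<le> (\<integral>x. tanh (x * t y + B y) \<partial>M) \<and>
      (\<integral>x. tanh (x * t y + B y) \<partial>M) \<le> (EW M + C) * t y"
    using B
  proof eventually_elim
    case (elim y)
    have "t y * (EW M / 2) \<le> t y * sech_moment 1 (t y) 0"
      using elim by (intro mult_left_mono) auto
    also have "\<dots> \<le> (\<integral>x. tanh (x * t y + B y) \<partial>M)"
      using elim by (intro expectation_tanh_lower) auto
    finally show ?case
      using expectation_tanh_upper[of "t y" "B y"] elim by (auto simp: algebra_simps)
  qed
qed (use mean_pos in simp)

definition crit :: real where "crit = 1 / second_moment"

lemma crit_pos: "0 < crit" using second_moment_pos by (simp add: crit_def)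

text \<open>If the fixed point stayed at or above some s > 0, monotonicity of D(t)/t would give
  D(s)/s \<le> E[W^2] - 1/\<theta>. The right side tends to 0 while the left is a fixed positive
  number.\<close>

lemma fixpt0_filterlim:
  fixes \<theta> :: "real \<Rightarrow> real"
  assumes lim: "(\<theta> \<longlongrightarrow> crit) (at a within S)" and gt: "\<forall>\<^sub>F y in at a within S. crit < \<theta> y"
  shows "filterlim (\<lambda>y. fixpt0 (\<theta> y)) (at_right 0) (at a within S)"
proof -
  have pos: "\<forall>\<^sub>F y in at a within S. 0 < \<theta> y \<and> 0 < fixpt0 (\<theta> y)"
    using gt
  proof eventually_elim
    case (elim y)
    then have "0 < \<theta> y" "1 < \<theta> y * second_moment"
      using order.strict_trans[OF crit_pos elim] second_moment_pos by (auto simp: crit_def field_simps)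
    then show ?case using fixpt0_pos by auto
  qed
  have "((\<lambda>y. fixpt0 (\<theta> y)) \<longlongrightarrow> 0) (at a within S)"
  proof (rule order_tendstoI)
    fix s :: real assume s: "0 < s"
    have "((\<lambda>y. second_moment - 1 / \<theta> y) \<longlongrightarrow> second_moment - 1 / crit) (at a within S)"
      using crit_pos by (intro tendsto_intros lim) auto
    then have "\<forall>\<^sub>F y in at a within S. second_moment - 1 / \<theta> y < gap_mean s / s"
      by (rule order_tendstoD) (use s gap_mean_pos[OF s] in \<open>simp add: crit_def\<close>)
    then show "\<forall>\<^sub>F y in at a within S. fixpt0 (\<theta> y) < s"
      using pos
    proof eventually_elim
      case (elim y)
      show ?case
      proof (rule ccontr)
        assume "\<not> fixpt0 (\<theta> y) < s"
        then have "gap_mean s / s \<le> gap_mean (fixpt0 (\<theta> y)) / fixpt0 (\<theta> y)"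
          using s by (intro gap_mean_ratio_mono) auto
        then show False using gap_mean_fixpt0[of "\<theta> y"] elim by simp
      qed
    qed
  next
    fix s :: real assume s: "s < 0"
    show "\<forall>\<^sub>F y in at a within S. s < fixpt0 (\<theta> y)"
      using pos by eventually_elim (use s in auto)
  qed
  then show ?thesis
    using pos by (auto simp: filterlim_at elim: eventually_mono)
qed

text \<open>As E[W^2] = 1/\<open>crit\<close>, the difference E[W^2] - 1/\<theta> is \<theta> -
  \<open>crit\<close> times the factor E[W^2]/\<theta>, which has a positive limit.\<close>

lemma gap_mean_fixpt0_bigtheta:
  fixes \<theta> :: "real \<Rightarrow> real"
  assumes lim: "(\<theta> \<longlongrightarrow> crit) (at a within S)" and gt: "\<forall>\<^sub>F y in at a within S. crit < \<theta> y"
    and e: "(\<lambda>y. \<theta> y - crit) \<in> \<Theta>[at a within S](e)"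
  shows "(\<lambda>y. gap_mean (fixpt0 (\<theta> y)) / fixpt0 (\<theta> y)) \<in> \<Theta>[at a within S](e)"
proof -
  have "(\<lambda>y. gap_mean (fixpt0 (\<theta> y)) / fixpt0 (\<theta> y)) \<in>
      \<Theta>[at a within S](\<lambda>y. (second_moment / \<theta> y) * (\<theta> y - crit))"
  proof (rule bigthetaI_cong)
    show "\<forall>\<^sub>F y in at a within S. gap_mean (fixpt0 (\<theta> y)) / fixpt0 (\<theta> y) =
        (second_moment / \<theta> y) * (\<theta> y - crit)"
      using gt
    proof eventually_elim
      case (elim y)
      then have p: "0 < \<theta> y" "1 < \<theta> y * second_moment"
        using order.strict_trans[OF crit_pos elim] second_moment_pos by (auto simp: crit_def field_simps)
      then show ?case
        unfolding gap_mean_fixpt0[OF p(1) fixpt0_pos[OF p]] using second_moment_pos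
        by (simp add: crit_def field_simps)
    qed
  qed
  also have "(\<lambda>y. (second_moment / \<theta> y) * (\<theta> y - crit)) \<in> \<Theta>[at a within S](\<lambda>y. 1 * e y)"
    by (intro landau_theta.mult e tendsto_imp_bigtheta_one[of _ "second_moment / crit"] tendsto_intros lim)
       (use crit_pos second_moment_pos in auto)
  finally show ?thesis by simp
qed

text \<open>Over the common denominator the numerator tends to \<open>crit\<close> E[W]^2 > 0, so
  only the denominator matters. Both sides of the critical point use this, hence e is merely
  nonzero.\<close>

lemma susc_bigtheta:
  fixes \<theta> t :: "real \<Rightarrow> real"
  assumes lim: "(\<theta> \<longlongrightarrow> crit) (at a within S)" and t: "(t \<longlongrightarrow> 0) (at a within S)"
    and e: "(\<lambda>y. 1 - \<theta> y * sech_moment 2 (t y) 0) \<in> \<Theta>[at a within S](e)"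
    and nz: "\<forall>\<^sub>F y in at a within S. e y \<noteq> 0"
  shows "(\<lambda>y. susc (\<theta> y) (t y) 0) \<in> \<Theta>[at a within S](\<lambda>y. 1 / e y)"
proof -
  let ?d = "\<lambda>y. 1 - \<theta> y * sech_moment 2 (t y) 0"
  have dnz: "\<forall>\<^sub>F y in at a within S. ?d y \<noteq> 0"
    using eventually_nonzero_bigtheta[OF e] nz by simp
  have "(\<lambda>y. susc (\<theta> y) (t y) 0) \<in> \<Theta>[at a within S](\<lambda>y.
      (sech_moment 0 (t y) 0 * ?d y + \<theta> y * (sech_moment 1 (t y) 0)\<^sup>2) / ?d y)"
    by (rule bigthetaI_cong) (use dnz in eventually_elim, simp add: susc_def add_divide_distrib)
  also have "(\<lambda>y. (sech_moment 0 (t y) 0 * ?d y + \<theta> y * (sech_moment 1 (t y) 0)\<^sup>2) / ?d y)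
      \<in> \<Theta>[at a within S](\<lambda>y. 1 / e y)"
  proof (rule bigtheta_quotient[OF _ e])
    show "(\<lambda>y. sech_moment 0 (t y) 0 * ?d y + \<theta> y * (sech_moment 1 (t y) 0)\<^sup>2) \<in> \<Theta>[at a within S](\<lambda>_. 1)"
    proof (rule tendsto_imp_bigtheta_one)
      show "((\<lambda>y. sech_moment 0 (t y) 0 * ?d y + \<theta> y * (sech_moment 1 (t y) 0)\<^sup>2) \<longlongrightarrow>
          sech_moment 0 0 0 * (1 - crit * sech_moment 2 0 0) + crit * (sech_moment 1 0 0)\<^sup>2) (at a within S)"
        by (intro tendsto_intros tendsto_sech_moment lim t) auto
      show "sech_moment 0 0 0 * (1 - crit * sech_moment 2 0 0) + crit * (sech_moment 1 0 0)\<^sup>2 \<noteq> 0"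
        unfolding sech_moment_zero using crit_pos mean_pos second_moment_pos by (simp add: crit_def)
    qed
  qed
  finally show ?thesis .
qed

text \<open>At criticality the fixed-point equation reads drive t B = t E[W^2]. The linear parts
  cancel and D(t) = drive t B - drive t 0 is the pure response to the field, between B
  E[W sech^2 (W t + B)] and B E[W].\<close>

lemma crit_isotherm:
  shows fixpt_crit_filterlim: "filterlim (fixpt crit) (at_right 0) (at_right 0)"
    and gap_mean_fixpt_crit: "(\<lambda>B. gap_mean (fixpt crit B)) \<in> \<Theta>[at_right 0](\<lambda>B. B)"
    and mag_crit_bigtheta: "mag crit \<in> \<Theta>[at_right 0](fixpt crit)"
proof -
  have "(fixpt crit \<longlongrightarrow> 0) (at_right 0)"
    using tendsto_fixpt0[OF crit_pos] fixpt0_zero[OF crit_pos] second_moment_pos by (simp add: crit_def)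
  moreover have pos: "\<forall>\<^sub>F B in at_right 0. 0 < fixpt crit B"
    using eventually_at_right_less[of 0] by eventually_elim (rule fixpt_pos[OF crit_pos])
  ultimately show lim: "filterlim (fixpt crit) (at_right 0) (at_right 0)"
    by (auto simp: filterlim_at elim: eventually_mono)
  have id: "drive (fixpt crit B) B = fixpt crit B * second_moment" if "0 < B" for B
    using fixpt_eq[OF crit_pos that] second_moment_pos by (simp add: crit_def field_simps)
  have upper: "gap_mean (fixpt crit B) \<le> B * EW M" if "0 < B" for B
  proof -
    let ?t = "fixpt crit B"
    have "drive ?t B \<le> (\<integral>x. x * tanh (x * ?t + 0) + B * x \<partial>M)"
      unfolding drive_def
    proof (rule integral_mono_AE[OF integrable_drive])
      show "AE x in M. x * tanh (x * ?t + B) \<le> x * tanh (x * ?t + 0) + B * x"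
        using nonneg
      proof eventually_elim
        case (elim x)
        have "tanh (x * ?t + B) \<le> tanh (x * ?t) + B"
          using tanh_gap_mono[of "x * ?t" "x * ?t + B"] that by (simp add: tanh_gap_def)
        from mult_left_mono[OF this elim] show ?case by (simp add: algebra_simps)
      qed
    qed (intro Bochner_Integration.integrable_add integrable_drive integrable_mult_right integrable_id)
    also have "\<dots> = drive ?t 0 + B * EW M"
      using integrable_drive[of ?t 0] integrable_id by (simp add: drive_def EW_def)
    finally show ?thesis using id[OF that] by (simp add: gap_mean_eq)
  qed
  have lower: "B * sech_moment 1 (fixpt crit B) B \<le> gap_mean (fixpt crit B)" if "0 < B" for B
  proof -
    let ?t = "fixpt crit B"
    have "(\<integral>x. x * tanh (x * ?t + 0) + B * (x ^ 1 * (1 - tanh (x * ?t + B) ^ 2)) \<partial>M) \<le> drive ?t B"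
      unfolding drive_def
    proof (rule integral_mono_AE[OF _ integrable_drive])
      show "AE x in M. x * tanh (x * ?t + 0) + B * (x ^ 1 * (1 - tanh (x * ?t + B) ^ 2)) \<le> x * tanh (x * ?t + B)"
        using nonneg
      proof eventually_elim
        case (elim x)
        have "B * (1 - tanh (x * ?t + B) ^ 2) \<le> tanh (x * ?t + B) - tanh (x * ?t)"
          using tanh_increment_lower[of "x * ?t" "x * ?t + B"] that fixpt_pos[OF crit_pos that] elim by simp
        from mult_left_mono[OF this elim] show ?case by (simp add: algebra_simps)
      qed
    qed (intro Bochner_Integration.integrable_add integrable_drive integrable_mult_right integrable_sech_moment, simp)
    also have "(\<integral>x. x * tanh (x * ?t + 0) + B * (x ^ 1 * (1 - tanh (x * ?t + B) ^ 2)) \<partial>M) =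
        drive ?t 0 + B * sech_moment 1 ?t B"
      unfolding drive_def sech_moment_def
      by (subst Bochner_Integration.integral_add)
         (use integrable_drive[of ?t 0] integrable_sech_moment[of 1 ?t B] in auto)
    finally show ?thesis using id[OF that] by (simp add: gap_mean_eq)
  qed
  have ev: "\<forall>\<^sub>F B in at_right 0. EW M / 2 * B \<le> gap_mean (fixpt crit B) \<and> gap_mean (fixpt crit B) \<le> EW M * B"
  proof -
    have "((\<lambda>B. sech_moment 1 (fixpt crit B) B) \<longlongrightarrow> sech_moment 1 0 0) (at_right 0)"
      using lim by (intro tendsto_sech_moment) (auto simp: filterlim_at)
    then have "\<forall>\<^sub>F B in at_right 0. EW M / 2 < sech_moment 1 (fixpt crit B) B"
      by (rule order_tendstoD(1)) (use mean_pos in \<open>simp add: sech_moment_zero[simplified]\<close>)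
    then show ?thesis
      using eventually_at_right_less[of 0]
    proof eventually_elim
      case (elim B)
      have "EW M / 2 * B \<le> B * sech_moment 1 (fixpt crit B) B"
        using mult_left_mono[of "EW M / 2" "sech_moment 1 (fixpt crit B) B" B] elim by simp
      then show ?case using lower[OF elim(2)] upper[OF elim(2)] by (simp add: mult.commute)
    qed
  qed
  show "(\<lambda>B. gap_mean (fixpt crit B)) \<in> \<Theta>[at_right 0](\<lambda>B. B)"
    by (rule bigtheta_sandwich[where c = "EW M / 2" and C = "EW M"])
       (use mean_pos in simp, use ev eventually_at_right_less[of 0] in eventually_elim, simp)
  \<comment> \<open>The magnetization estimate needs B = O(t). It follows from D(t) \<ge> B E[W]/2
    and D(t) \<le> t E[W^2].\<close>
  have "\<forall>\<^sub>F B in at_right 0. 0 \<le> B \<and> B \<le> (2 * second_moment / EW M) * fixpt crit B"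
    using ev pos eventually_at_right_less[of 0]
  proof eventually_elim
    case (elim B)
    have "0 \<le> drive (fixpt crit B) 0"
      using drive_mono[of 0 "fixpt crit B" 0 0] elim by (simp add: drive_def)
    then have "EW M / 2 * B \<le> fixpt crit B * second_moment"
      using elim by (simp add: gap_mean_eq)
    then show ?case using elim mean_pos by (simp add: field_simps)
  qed
  then show "mag crit \<in> \<Theta>[at_right 0](fixpt crit)"
    unfolding mag_def[abs_def] by (rule expectation_tanh_bigtheta[OF lim])
qed

section \<open>From the reduced fixed point to the annealed quantities\<close>

lemma zstar_eq:
  assumes "0 < sh \<beta>" "0 < B"
  shows "alpha M sh \<beta> * zstar M sh \<beta> B = fixpt (sh \<beta> / EW M) B"
proof -
  define \<theta> where "\<theta> = sh \<beta> / EW M"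
  define a where "a = alpha M sh \<beta>"
  have th: "0 < \<theta>" using assms mean_pos by (simp add: \<theta>_def)
  \<comment> \<open>The equation for z contains a once inside tanh and once as a prefactor. The
    first is absorbed by t = a z; multiplying the equation by a turns the second into
    \<theta>.\<close>
  have a: "0 < a" "a * a = \<theta>" using th by (simp_all add: a_def alpha_def flip: \<theta>_def)
  have int: "(\<integral>x. tanh (a * x * z + B) * (a * x) \<partial>M) = a * drive (a * z) B" for z
    by (simp add: drive_def mult_ac flip: integral_mult_right_zero)
  have "zstar M sh \<beta> B = fixpt \<theta> B / a"
    unfolding zstar_def a_def[symmetric] int
  proof (rule the_equality)
    show "0 < fixpt \<theta> B / a \<and> fixpt \<theta> B / a = a * drive (a * (fixpt \<theta> B / a)) B"
    proof -
      have "fixpt \<theta> B = a * (a * drive (fixpt \<theta> B) B)"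
        using fixpt_eq[OF th assms(2)] a(2) by (metis mult.assoc)
      then show ?thesis using fixpt_pos[OF th assms(2)] a(1) by (simp add: divide_eq_eq mult.commute)
    qed
  next
    fix z assume z: "0 < z \<and> z = a * drive (a * z) B"
    then have "a * z = \<theta> * drive (a * z) B" by (metis a(2) mult.assoc)
    then have "a * z = fixpt \<theta> B" using z a th assms by (intro fixpt_eqI) auto
    then show "z = fixpt \<theta> B / a" using a by (simp add: field_simps)
  qed
  then show ?thesis using a by (simp add: a_def \<theta>_def)
qed

lemma Mtil_eq_mag:
  assumes "0 < sh \<beta>" "0 < B" shows "Mtil M sh \<beta> B = mag (sh \<beta> / EW M) B"
proof -
  have "alpha M sh \<beta> * x * zstar M sh \<beta> B = x * fixpt (sh \<beta> / EW M) B" for x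
    unfolding zstar_eq[of sh, OF assms, symmetric] by (simp only: mult_ac)
  then show ?thesis unfolding Mtil_def mag_def by presburger
qed

lemma Mtil0_eq:
  assumes "0 < sh \<beta>"
  shows "Mtil0 M sh \<beta> = (\<integral>x. tanh (x * fixpt0 (sh \<beta> / EW M)) \<partial>M)"
  unfolding Mtil0_def
proof (rule tendsto_Lim)
  show "(Mtil M sh \<beta> \<longlongrightarrow> (\<integral>x. tanh (x * fixpt0 (sh \<beta> / EW M)) \<partial>M)) (at_right 0)"
    by (rule Lim_transform_eventually[OF tendsto_mag0])
       (use assms mean_pos in simp, use eventually_at_right_less[of 0] in eventually_elim,
         use Mtil_eq_mag[of sh, OF assms] in simp)
qed simp

lemma chitil0_eq:
  assumes "0 < sh \<beta>" "sh \<beta> / EW M \<noteq> crit"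
  shows "chitil0 M sh \<beta> = susc (sh \<beta> / EW M) (fixpt0 (sh \<beta> / EW M)) 0"
  unfolding chitil0_def
proof (rule tendsto_Lim)
  have th: "0 < sh \<beta> / EW M" using assms mean_pos by simp
  have "sh \<beta> / EW M * second_moment \<noteq> 1"
    using assms(2) second_moment_pos by (simp add: crit_def field_simps)
  from tendsto_deriv_mag[OF th this]
  show "(chitil M sh \<beta> \<longlongrightarrow> susc (sh \<beta> / EW M) (fixpt0 (sh \<beta> / EW M)) 0) (at_right 0)"
  proof (rule Lim_transform_eventually)
    show "\<forall>\<^sub>F B in at_right 0. deriv (mag (sh \<beta> / EW M)) B = chitil M sh \<beta> B"
      using eventually_at_right_less[of 0]
    proof eventually_elim
      case (elim B)
      \<comment> \<open>\<open>Mtil\<close> and \<open>mag\<close> are identified for positive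
        fields only; a derivative at B > 0 sees just a neighbourhood inside that range.\<close>
      have "\<forall>\<^sub>F y in nhds B. 0 < y" using eventually_nhds_in_open[of "{0<..}" B] elim by simp
      then have "\<forall>\<^sub>F y in nhds B. mag (sh \<beta> / EW M) y = Mtil M sh \<beta> y"
        by eventually_elim (use Mtil_eq_mag[of sh, OF assms(1)] in simp)
      then show ?case unfolding chitil_def by (intro deriv_cong_ev) auto
    qed
  qed
qed simp

text \<open>All that is asked of sh: its value at the critical point and a positive derivative
  there. Then \<theta> - \<open>crit\<close> is of order \<beta> - \<beta>c with the same
  sign.\<close>

lemma parameter_near_crit:
  assumes d: "(sh has_real_derivative d) (at \<beta>c)" "0 < d" and c: "sh \<beta>c / EW M = crit"
    and \<theta>_def: "\<theta> = (\<lambda>\<beta>. sh \<beta> / EW M)"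
  shows parameter_tendsto: "(\<theta> \<longlongrightarrow> crit) (at \<beta>c)"
    and parameter_bigtheta: "(\<lambda>\<beta>. \<theta> \<beta> - crit) \<in> \<Theta>[at \<beta>c](\<lambda>\<beta>. \<beta> - \<beta>c)"
    and parameter_pos: "\<forall>\<^sub>F \<beta> in at \<beta>c. 0 < sh \<beta>"
    and parameter_sign: "\<forall>\<^sub>F \<beta> in at \<beta>c. (\<beta>c < \<beta> \<longrightarrow> crit < \<theta> \<beta>) \<and> (\<beta> < \<beta>c \<longrightarrow> \<theta> \<beta> < crit)"
proof -
  have D: "(\<theta> has_real_derivative d / EW M) (at \<beta>c)"
    unfolding \<theta>_def by (rule DERIV_cdivide[OF d(1)])
  have dp: "0 < d / EW M" using d mean_pos by simp
  have th: "\<theta> \<beta>c = crit" using c by (simp add: \<theta>_def)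
  have lim: "((\<lambda>\<beta>. (\<theta> \<beta> - crit) / (\<beta> - \<beta>c)) \<longlongrightarrow> d / EW M) (at \<beta>c)"
    using D th by (simp add: has_field_derivative_iff)
  show t: "(\<theta> \<longlongrightarrow> crit) (at \<beta>c)" using DERIV_isCont[OF D] th by (simp add: isCont_def)
  show "(\<lambda>\<beta>. \<theta> \<beta> - crit) \<in> \<Theta>[at \<beta>c](\<lambda>\<beta>. \<beta> - \<beta>c)"
    by (rule bigthetaI_tendsto[OF _ lim]) (use d mean_pos in simp)
  have "\<forall>\<^sub>F \<beta> in at \<beta>c. 0 < \<theta> \<beta>" by (rule order_tendstoD(1)[OF t crit_pos])
  then show "\<forall>\<^sub>F \<beta> in at \<beta>c. 0 < sh \<beta>"
    by eventually_elim (use mean_pos in \<open>simp add: \<theta>_def zero_less_divide_iff\<close>)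
  have "\<forall>\<^sub>F \<beta> in at \<beta>c. 0 < (\<theta> \<beta> - crit) / (\<beta> - \<beta>c)" by (rule order_tendstoD(1)[OF lim dp])
  then show "\<forall>\<^sub>F \<beta> in at \<beta>c. (\<beta>c < \<beta> \<longrightarrow> crit < \<theta> \<beta>) \<and> (\<beta> < \<beta>c \<longrightarrow> \<theta> \<beta> < crit)"
    by eventually_elim (auto simp: zero_less_divide_iff)
qed

text \<open>Comparability of \<open>defect_mean\<close> and \<open>gap_mean\<close> is a premise of
  the last conclusion, where it transfers the known order of D(t)/t to the susceptibility
  denominator.\<close>

lemma above_crit:
  assumes d: "(sh has_real_derivative d) (at \<beta>c)" "0 < d" and c: "sh \<beta>c / EW M = crit"
    and \<theta>_def: "\<theta> = (\<lambda>\<beta>. sh \<beta> / EW M)"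
  shows above_crit_filterlim: "filterlim (\<lambda>\<beta>. fixpt0 (\<theta> \<beta>)) (at_right 0) (at_right \<beta>c)"
    and above_crit_gap: "(\<lambda>\<beta>. gap_mean (fixpt0 (\<theta> \<beta>)) / fixpt0 (\<theta> \<beta>)) \<in> \<Theta>[at_right \<beta>c](\<lambda>\<beta>. \<beta> - \<beta>c)"
    and above_crit_Mtil0: "Mtil0 M sh \<in> \<Theta>[at_right \<beta>c](\<lambda>\<beta>. fixpt0 (\<theta> \<beta>))"
    and above_crit_chitil0: "defect_mean \<in> \<Theta>[at_right 0](gap_mean) \<Longrightarrow>
      chitil0 M sh \<in> \<Theta>[at_right \<beta>c](\<lambda>\<beta>. (\<beta> - \<beta>c) powr (- 1))"
proof -
  note near = parameter_near_crit[OF d c \<theta>_def]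
  have le: "at_right \<beta>c \<le> at \<beta>c" by (simp add: at_le)
  have lim: "(\<theta> \<longlongrightarrow> crit) (at_right \<beta>c)" by (rule tendsto_mono[OF le near(1)])
  have gt: "\<forall>\<^sub>F \<beta> in at_right \<beta>c. crit < \<theta> \<beta>"
    using filter_leD[OF le near(4)] eventually_at_right_less[of \<beta>c] by eventually_elim auto
  have pos: "\<forall>\<^sub>F \<beta> in at_right \<beta>c. 0 < sh \<beta>" by (rule filter_leD[OF le near(3)])
  have e: "(\<lambda>\<beta>. \<theta> \<beta> - crit) \<in> \<Theta>[at_right \<beta>c](\<lambda>\<beta>. \<beta> - \<beta>c)"
    by (rule landau_theta.filter_mono[OF le near(2)])
  show T: "filterlim (\<lambda>\<beta>. fixpt0 (\<theta> \<beta>)) (at_right 0) (at_right \<beta>c)"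
    by (rule fixpt0_filterlim[OF lim gt])
  show g: "(\<lambda>\<beta>. gap_mean (fixpt0 (\<theta> \<beta>)) / fixpt0 (\<theta> \<beta>)) \<in> \<Theta>[at_right \<beta>c](\<lambda>\<beta>. \<beta> - \<beta>c)"
    by (rule gap_mean_fixpt0_bigtheta[OF lim gt e])
  have "Mtil0 M sh \<in> \<Theta>[at_right \<beta>c](\<lambda>\<beta>. \<integral>x. tanh (x * fixpt0 (\<theta> \<beta>) + 0) \<partial>M)"
    by (rule bigthetaI_cong) (use pos in eventually_elim, simp add: Mtil0_eq \<theta>_def)
  also have "(\<lambda>\<beta>. \<integral>x. tanh (x * fixpt0 (\<theta> \<beta>) + 0) \<partial>M) \<in> \<Theta>[at_right \<beta>c](\<lambda>\<beta>. fixpt0 (\<theta> \<beta>))"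
  proof (rule expectation_tanh_bigtheta[OF T, of _ 0])
    show "\<forall>\<^sub>F y in at_right \<beta>c. (0::real) \<le> 0 \<and> 0 \<le> 0 * fixpt0 (\<theta> y)" by simp
  qed
  finally show "Mtil0 M sh \<in> \<Theta>[at_right \<beta>c](\<lambda>\<beta>. fixpt0 (\<theta> \<beta>))" .
  assume k: "defect_mean \<in> \<Theta>[at_right 0](gap_mean)"
  have den: "(\<lambda>\<beta>. 1 - \<theta> \<beta> * sech_moment 2 (fixpt0 (\<theta> \<beta>)) 0) \<in> \<Theta>[at_right \<beta>c](\<lambda>\<beta>. \<beta> - \<beta>c)"
  proof -
    have "(\<lambda>\<beta>. 1 - \<theta> \<beta> * sech_moment 2 (fixpt0 (\<theta> \<beta>)) 0) \<in>
        \<Theta>[at_right \<beta>c](\<lambda>\<beta>. \<theta> \<beta> * (defect_mean (fixpt0 (\<theta> \<beta>)) / fixpt0 (\<theta> \<beta>)))"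
    proof (rule bigthetaI_cong)
      show "\<forall>\<^sub>F \<beta> in at_right \<beta>c. 1 - \<theta> \<beta> * sech_moment 2 (fixpt0 (\<theta> \<beta>)) 0 =
          \<theta> \<beta> * (defect_mean (fixpt0 (\<theta> \<beta>)) / fixpt0 (\<theta> \<beta>))"
        using gt
      proof eventually_elim
        case (elim \<beta>)
        then have p: "0 < \<theta> \<beta>" "1 < \<theta> \<beta> * second_moment"
          using order.strict_trans[OF crit_pos elim] second_moment_pos by (auto simp: crit_def field_simps)
        show ?case using one_minus_sech_defect[OF fixpt0_pos[OF p] fixpt0_eq[OF p(1)]] by simp
      qed
    qed
    also have "(\<lambda>\<beta>. \<theta> \<beta> * (defect_mean (fixpt0 (\<theta> \<beta>)) / fixpt0 (\<theta> \<beta>))) \<in>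
        \<Theta>[at_right \<beta>c](\<lambda>\<beta>. 1 * (gap_mean (fixpt0 (\<theta> \<beta>)) / fixpt0 (\<theta> \<beta>)))"
      by (intro landau_theta.mult bigtheta_quotient tendsto_imp_bigtheta_one[OF lim]
            landau_theta.compose[OF k T]) (use crit_pos in auto)
    also have "(\<lambda>\<beta>. 1 * (gap_mean (fixpt0 (\<theta> \<beta>)) / fixpt0 (\<theta> \<beta>))) \<in> \<Theta>[at_right \<beta>c](\<lambda>\<beta>. \<beta> - \<beta>c)"
      using g by simp
    finally show ?thesis .
  qed
  have "chitil0 M sh \<in> \<Theta>[at_right \<beta>c](\<lambda>\<beta>. susc (\<theta> \<beta>) (fixpt0 (\<theta> \<beta>)) 0)"
    by (rule bigthetaI_cong) (use pos gt in eventually_elim, auto simp: chitil0_eq \<theta>_def)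
  also have "(\<lambda>\<beta>. susc (\<theta> \<beta>) (fixpt0 (\<theta> \<beta>)) 0) \<in> \<Theta>[at_right \<beta>c](\<lambda>\<beta>. 1 / (\<beta> - \<beta>c))"
    by (rule susc_bigtheta[OF lim _ den])
       (use T in \<open>simp add: filterlim_at\<close>, use eventually_at_right_less[of \<beta>c] in eventually_elim, simp)
  also have "(\<lambda>\<beta>. 1 / (\<beta> - \<beta>c)) \<in> \<Theta>[at_right \<beta>c](\<lambda>\<beta>. (\<beta> - \<beta>c) powr (- 1))"
    by (rule bigthetaI_cong)
       (use eventually_at_right_less[of \<beta>c] in eventually_elim, simp add: powr_minus_divide)
  finally show "chitil0 M sh \<in> \<Theta>[at_right \<beta>c](\<lambda>\<beta>. (\<beta> - \<beta>c) powr (- 1))" .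
qed

lemma below_crit_chitil0:
  assumes d: "(sh has_real_derivative d) (at \<beta>c)" "0 < d" and c: "sh \<beta>c / EW M = crit"
  shows "chitil0 M sh \<in> \<Theta>[at_left \<beta>c](\<lambda>\<beta>. (\<beta>c - \<beta>) powr (- 1))"
proof -
  define \<theta> where "\<theta> = (\<lambda>\<beta>. sh \<beta> / EW M)"
  note near = parameter_near_crit[OF d c \<theta>_def]
  have le: "at_left \<beta>c \<le> at \<beta>c" by (simp add: at_le)
  have lim: "(\<theta> \<longlongrightarrow> crit) (at_left \<beta>c)" by (rule tendsto_mono[OF le near(1)])
  have ev: "\<forall>\<^sub>F \<beta> in at_left \<beta>c. \<beta> < \<beta>c" by (simp add: eventually_at_filter)
  have lt: "\<forall>\<^sub>F \<beta> in at_left \<beta>c. \<theta> \<beta> < crit"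
    using filter_leD[OF le near(4)] ev by eventually_elim auto
  have pos: "\<forall>\<^sub>F \<beta> in at_left \<beta>c. 0 < sh \<beta>" by (rule filter_leD[OF le near(3)])
  have e: "(\<lambda>\<beta>. \<theta> \<beta> - crit) \<in> \<Theta>[at_left \<beta>c](\<lambda>\<beta>. \<beta> - \<beta>c)"
    by (rule landau_theta.filter_mono[OF le near(2)])
  have "(\<lambda>\<beta>. 1 - \<theta> \<beta> * sech_moment 2 0 0) \<in> \<Theta>[at_left \<beta>c](\<lambda>\<beta>. (- second_moment) * (\<theta> \<beta> - crit))"
    unfolding sech_moment_zero using second_moment_pos
    by (intro bigthetaI_cong always_eventually) (auto simp: crit_def field_simps)
  also have "(\<lambda>\<beta>. (- second_moment) * (\<theta> \<beta> - crit)) \<in> \<Theta>[at_left \<beta>c](\<lambda>\<beta>. \<beta> - \<beta>c)"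
    using e second_moment_pos by (subst landau_theta.cmult_in_iff) auto
  finally have den: "(\<lambda>\<beta>. 1 - \<theta> \<beta> * sech_moment 2 0 0) \<in> \<Theta>[at_left \<beta>c](\<lambda>\<beta>. \<beta> - \<beta>c)" .
  have "chitil0 M sh \<in> \<Theta>[at_left \<beta>c](\<lambda>\<beta>. susc (\<theta> \<beta>) 0 0)"
  proof (rule bigthetaI_cong)
    show "\<forall>\<^sub>F \<beta> in at_left \<beta>c. chitil0 M sh \<beta> = susc (\<theta> \<beta>) 0 0"
      using pos lt
    proof eventually_elim
      case (elim \<beta>)
      have "fixpt0 (\<theta> \<beta>) = 0"
        using elim mean_pos second_moment_pos
        by (intro fixpt0_zero) (auto simp: \<theta>_def crit_def field_simps)
      then show ?case using elim chitil0_eq[of sh \<beta>] by (simp add: \<theta>_def)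
    qed
  qed
  also have "(\<lambda>\<beta>. susc (\<theta> \<beta>) 0 0) \<in> \<Theta>[at_left \<beta>c](\<lambda>\<beta>. 1 / (\<beta> - \<beta>c))"
    by (rule susc_bigtheta[OF lim _ den]) (simp, use ev in eventually_elim, simp)
  \<comment> \<open>On this side \<beta> - \<beta>c is negative; the relation compares absolute
    values, so only the sign changes.\<close>
  also have "(\<lambda>\<beta>. 1 / (\<beta> - \<beta>c)) \<in> \<Theta>[at_left \<beta>c](\<lambda>\<beta>. (\<beta>c - \<beta>) powr (- 1))"
    by (rule bigthetaI'[of 1 1])
       (simp, simp, use ev in eventually_elim, simp add: powr_minus_divide abs_minus_commute)
  finally show ?thesis .
qed

lemma Mtil_crit_bigtheta:
  assumes "sh \<beta>c / EW M = crit"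
  shows "Mtil M sh \<beta>c \<in> \<Theta>[at_right 0](fixpt crit)"
proof -
  have "0 < sh \<beta>c" using assms crit_pos mean_pos by (metis zero_less_divide_iff order.asym)
  then have "Mtil M sh \<beta>c \<in> \<Theta>[at_right 0](mag crit)"
    by (intro bigthetaI_cong)
       (use eventually_at_right_less[of 0] in eventually_elim, simp add: Mtil_eq_mag assms)
  also note mag_crit_bigtheta
  finally show ?thesis .
qed

text \<open>If D(t) has order t^p, then D(t)/t \<asymp> \<beta> - \<beta>c yields the exponent 1/(p
  - 1), and D(t) \<asymp> B yields 1/p. Finite fourth moment corresponds to p = 3, a power law to p
  = \<tau> - 2.\<close>

lemma crit_exps_of_gap:
  assumes gap: "gap_mean \<in> \<Theta>[at_right 0](\<lambda>t. t powr p)"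
    and defect: "defect_mean \<in> \<Theta>[at_right 0](\<lambda>t. t powr p)" and p: "1 < p"
    and d: "(sh has_real_derivative d) (at \<beta>c)" "0 < d" and c: "sh \<beta>c / EW M = crit"
  shows "has_crit_exps M sh \<beta>c (1 / (p - 1)) p 1 1"
  unfolding has_crit_exps_def
proof (intro conjI)
  define \<theta> where "\<theta> = (\<lambda>\<beta>. sh \<beta> / EW M)"
  note above = above_crit[OF d c \<theta>_def]
  have ev: "\<forall>\<^sub>F \<beta> in at_right \<beta>c. 0 < fixpt0 (\<theta> \<beta>)"
    using above(1) eventually_at_right_less[of 0] unfolding filterlim_iff by blast
  note above(3)
  also have "(\<lambda>\<beta>. fixpt0 (\<theta> \<beta>)) \<in> \<Theta>[at_right \<beta>c](\<lambda>\<beta>. (\<beta> - \<beta>c) powr (1 / (p - 1)))"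
  proof (rule bigtheta_inverse_powr)
    have "(\<lambda>\<beta>. fixpt0 (\<theta> \<beta>) powr (p - 1)) \<in> \<Theta>[at_right \<beta>c](\<lambda>\<beta>. fixpt0 (\<theta> \<beta>) powr p / fixpt0 (\<theta> \<beta>))"
      by (rule bigthetaI_cong) (use ev in eventually_elim, simp add: powr_diff)
    also have "(\<lambda>\<beta>. fixpt0 (\<theta> \<beta>) powr p / fixpt0 (\<theta> \<beta>)) \<in>
        \<Theta>[at_right \<beta>c](\<lambda>\<beta>. gap_mean (fixpt0 (\<theta> \<beta>)) / fixpt0 (\<theta> \<beta>))"
      using landau_theta.compose[OF gap above(1)] by (intro bigtheta_quotient) (auto simp: bigtheta_sym)
    also note above(2)
    finally show "(\<lambda>\<beta>. fixpt0 (\<theta> \<beta>) powr (p - 1)) \<in> \<Theta>[at_right \<beta>c](\<lambda>\<beta>. \<beta> - \<beta>c)" .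
    show "\<forall>\<^sub>F \<beta> in at_right \<beta>c. 0 < \<beta> - \<beta>c"
      using eventually_at_right_less[of \<beta>c] by eventually_elim simp
  qed (use p ev in auto)
  finally show "Mtil0 M sh \<in> \<Theta>[at_right \<beta>c](\<lambda>\<beta>. (\<beta> - \<beta>c) powr (1 / (p - 1)))" .
  note Mtil_crit_bigtheta[of sh, OF c]
  also have "fixpt crit \<in> \<Theta>[at_right 0](\<lambda>B. B powr (1 / p))"
  proof (rule bigtheta_inverse_powr)
    have "(\<lambda>B. fixpt crit B powr p) \<in> \<Theta>[at_right 0](\<lambda>B. gap_mean (fixpt crit B))"
      using landau_theta.compose[OF gap fixpt_crit_filterlim] by (simp add: bigtheta_sym)
    also note gap_mean_fixpt_crit
    finally show "(\<lambda>B. fixpt crit B powr p) \<in> \<Theta>[at_right 0](\<lambda>B. B)" .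
    show "\<forall>\<^sub>F B in at_right 0. 0 < fixpt crit B"
      using eventually_at_right_less[of 0] by eventually_elim (rule fixpt_pos[OF crit_pos])
  qed (use p eventually_at_right_less[of 0] in auto)
  finally show "Mtil M sh \<beta>c \<in> \<Theta>[at_right 0](\<lambda>B. B powr (1 / p))" .
  show "chitil0 M sh \<in> \<Theta>[at_left \<beta>c](\<lambda>\<beta>. (\<beta>c - \<beta>) powr - 1)"
    by (rule below_crit_chitil0[OF d c])
  have "defect_mean \<in> \<Theta>[at_right 0](gap_mean)"
    using gap by (subst landau_theta.cong_bigtheta[OF gap]) (rule defect)
  then show "chitil0 M sh \<in> \<Theta>[at_right \<beta>c](\<lambda>\<beta>. (\<beta> - \<beta>c) powr - 1)"
    by (rule above(4))
qed

text \<open>The relations for D(t)/t and D(t) now carry a logarithm and are inverted with q = 2 and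
  q = 3.\<close>

lemma boundary_of_gap:
  assumes gap: "gap_mean \<in> \<Theta>[at_right 0](\<lambda>t. t powr 3 * ln (1 / t))"
    and d: "(sh has_real_derivative d) (at \<beta>c)" "0 < d" and c: "sh \<beta>c / EW M = crit"
  shows "boundary_behaviour M sh \<beta>c"
  unfolding boundary_behaviour_def
proof (intro conjI)
  define \<theta> where "\<theta> = (\<lambda>\<beta>. sh \<beta> / EW M)"
  note above = above_crit[OF d c \<theta>_def]
  have ev: "\<forall>\<^sub>F \<beta> in at_right \<beta>c. 0 < fixpt0 (\<theta> \<beta>)"
    using above(1) eventually_at_right_less[of 0] unfolding filterlim_iff by blast
  note above(3)
  also have "(\<lambda>\<beta>. fixpt0 (\<theta> \<beta>)) \<in> \<Theta>[at_right \<beta>c](\<lambda>\<beta>. ((\<beta> - \<beta>c) / ln (1 / (\<beta> - \<beta>c))) powr (1 / 2))"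
  proof (rule bigtheta_inverse_powr_log[OF _ _ above(1)])
    have "(\<lambda>\<beta>. fixpt0 (\<theta> \<beta>) powr 2 * ln (1 / fixpt0 (\<theta> \<beta>))) \<in>
        \<Theta>[at_right \<beta>c](\<lambda>\<beta>. (fixpt0 (\<theta> \<beta>) powr 3 * ln (1 / fixpt0 (\<theta> \<beta>))) / fixpt0 (\<theta> \<beta>))"
      by (rule bigthetaI_cong)
         (use ev in eventually_elim, simp add: powr_numeral eval_nat_numeral)
    also have "(\<lambda>\<beta>. (fixpt0 (\<theta> \<beta>) powr 3 * ln (1 / fixpt0 (\<theta> \<beta>))) / fixpt0 (\<theta> \<beta>)) \<in>
        \<Theta>[at_right \<beta>c](\<lambda>\<beta>. gap_mean (fixpt0 (\<theta> \<beta>)) / fixpt0 (\<theta> \<beta>))"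
      using landau_theta.compose[OF gap above(1)] by (intro bigtheta_quotient) (auto simp: bigtheta_sym)
    also note above(2)
    finally show "(\<lambda>\<beta>. fixpt0 (\<theta> \<beta>) powr 2 * ln (1 / fixpt0 (\<theta> \<beta>))) \<in> \<Theta>[at_right \<beta>c](\<lambda>\<beta>. \<beta> - \<beta>c)" .
    show "\<forall>\<^sub>F \<beta> in at_right \<beta>c. 0 < \<beta> - \<beta>c"
      using eventually_at_right_less[of \<beta>c] by eventually_elim simp
  qed simp
  finally show "Mtil0 M sh \<in> \<Theta>[at_right \<beta>c](\<lambda>\<beta>. ((\<beta> - \<beta>c) / ln (1 / (\<beta> - \<beta>c))) powr (1 / 2))" .
  note Mtil_crit_bigtheta[of sh, OF c]
  also have "fixpt crit \<in> \<Theta>[at_right 0](\<lambda>B. (B / ln (1 / B)) powr (1 / 3))"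
  proof (rule bigtheta_inverse_powr_log[OF _ _ fixpt_crit_filterlim])
    have "(\<lambda>B. fixpt crit B powr 3 * ln (1 / fixpt crit B)) \<in> \<Theta>[at_right 0](\<lambda>B. gap_mean (fixpt crit B))"
      using landau_theta.compose[OF gap fixpt_crit_filterlim] by (simp add: bigtheta_sym)
    also note gap_mean_fixpt_crit
    finally show "(\<lambda>B. fixpt crit B powr 3 * ln (1 / fixpt crit B)) \<in> \<Theta>[at_right 0](\<lambda>B. B)" .
  qed (use eventually_at_right_less[of 0] in auto)
  finally show "Mtil M sh \<beta>c \<in> \<Theta>[at_right 0](\<lambda>B. (B / ln (1 / B)) powr (1 / 3))" .
qed

section \<open>Moment estimates\<close>

text \<open>With x clamped to [a, b], the increment of F is the integral of f over the u in [a, b]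
  with u \<le> x. Exchanging the integrals leaves the tail probability of u; nonnegativity lets this
  happen without integrability conditions.\<close>

lemma layer_cake:
  fixes F f :: "real \<Rightarrow> real"
  assumes "a \<le> b" and [measurable]: "f \<in> borel_measurable borel"
    and F: "\<And>u. a \<le> u \<Longrightarrow> u \<le> b \<Longrightarrow> (F has_real_derivative f u) (at u)"
    and f: "\<And>u. a \<le> u \<Longrightarrow> u \<le> b \<Longrightarrow> 0 \<le> f u"
  shows "(\<integral>\<^sup>+x. ennreal (F (min (max x a) b) - F a) \<partial>M) =
    (\<integral>\<^sup>+u. ennreal (f u * measure M {u..}) * indicator {a..b} u \<partial>lborel)"
proof -
  interpret pair_sigma_finite M lborel ..
  have "(\<integral>\<^sup>+x. ennreal (F (min (max x a) b) - F a) \<partial>M) =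
      (\<integral>\<^sup>+x. (\<integral>\<^sup>+u. (ennreal (f u) * indicator {a..b} u) * (if u \<le> x then 1 else 0) \<partial>lborel) \<partial>M)"
  proof (rule nn_integral_cong)
    fix x
    show "ennreal (F (min (max x a) b) - F a) =
        (\<integral>\<^sup>+u. (ennreal (f u) * indicator {a..b} u) * (if u \<le> x then 1 else 0) \<partial>lborel)"
    proof (cases "a \<le> x")
      case True
      have "(\<integral>\<^sup>+u. (ennreal (f u) * indicator {a..b} u) * (if u \<le> x then 1 else 0) \<partial>lborel) =
          (\<integral>\<^sup>+u. ennreal (f u) * indicator {a..min x b} u \<partial>lborel)"
        by (intro nn_integral_cong) (auto split: split_indicator)
      also have "\<dots> = ennreal (F (min x b) - F a)"
        using True assms(1) by (intro nn_integral_FTC_Icc F f) auto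
      finally show ?thesis using True by (simp add: max_def)
    next
      case False
      have "(\<integral>\<^sup>+u. (ennreal (f u) * indicator {a..b} u) * (if u \<le> x then 1 else 0) \<partial>lborel) =
          (\<integral>\<^sup>+u. 0 \<partial>(lborel :: real measure))"
        using False by (intro nn_integral_cong) (auto split: split_indicator)
      then show ?thesis using False assms(1) by (simp add: max_def min_def)
    qed
  qed
  also have "\<dots> = (\<integral>\<^sup>+u. (\<integral>\<^sup>+x. (ennreal (f u) * indicator {a..b} u) * (if u \<le> x then 1 else 0) \<partial>M) \<partial>lborel)"
    by (rule Fubini'[symmetric]) measurable
  also have "\<dots> = (\<integral>\<^sup>+u. ennreal (f u * measure M {u..}) * indicator {a..b} u \<partial>lborel)"
  proof (rule nn_integral_cong)
    fix u :: real
    have "(\<integral>\<^sup>+x. (if u \<le> x then 1 else 0) \<partial>M) = (\<integral>\<^sup>+x. indicator {u..} x \<partial>M)"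
      by (intro nn_integral_cong) (auto split: split_indicator)
    also have "\<dots> = ennreal (measure M {u..})" by (simp add: emeasure_eq_measure)
    finally have "(\<integral>\<^sup>+x. (ennreal (f u) * indicator {a..b} u) * (if u \<le> x then 1 else 0) \<partial>M) =
        (ennreal (f u) * indicator {a..b} u) * ennreal (measure M {u..})"
      by (subst nn_integral_cmult) auto
    also have "\<dots> = ennreal (f u * measure M {u..}) * indicator {a..b} u"
      using f[of u] by (auto simp: ennreal_mult' split: split_indicator)
    finally show "(\<integral>\<^sup>+x. (ennreal (f u) * indicator {a..b} u) * (if u \<le> x then 1 else 0) \<partial>M) =
        ennreal (f u * measure M {u..}) * indicator {a..b} u" .
  qed
  finally show ?thesis .
qed

lemma clamp_expectation:
  fixes F f :: "real \<Rightarrow> real"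
  assumes "a \<le> b" and [measurable]: "F \<in> borel_measurable borel"
    and F: "\<And>u. a \<le> u \<Longrightarrow> u \<le> b \<Longrightarrow> (F has_real_derivative f u) (at u)"
    and f: "\<And>u. a \<le> u \<Longrightarrow> u \<le> b \<Longrightarrow> 0 \<le> f u"
  shows integrable_clamp: "integrable M (\<lambda>x. F (min (max x a) b) - F a)"
    and nn_integral_clamp: "(\<integral>\<^sup>+x. ennreal (F (min (max x a) b) - F a) \<partial>M) =
      ennreal (\<integral>x. F (min (max x a) b) - F a \<partial>M)"
    and integral_clamp_nonneg: "0 \<le> (\<integral>x. F (min (max x a) b) - F a \<partial>M)"
proof -
  have mono: "F u \<le> F v" if "a \<le> u" "u \<le> v" "v \<le> b" for u v
    using that by (intro DERIV_nonneg_imp_nondecreasing[of u v F]) (auto intro!: exI[of _ "f _"] F f)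
  have bnd: "0 \<le> F (min (max x a) b) - F a" "F (min (max x a) b) \<le> F b" for x
    using mono[of a "min (max x a) b"] mono[of "min (max x a) b" b] assms(1) by auto
  show int: "integrable M (\<lambda>x. F (min (max x a) b) - F a)"
    by (rule integrable_const_bound[of _ "F b - F a"]) (use bnd in auto)
  show "(\<integral>\<^sup>+x. ennreal (F (min (max x a) b) - F a) \<partial>M) = ennreal (\<integral>x. F (min (max x a) b) - F a \<partial>M)"
    by (rule nn_integral_eq_integral[OF int]) (use bnd in auto)
  show "0 \<le> (\<integral>x. F (min (max x a) b) - F a \<partial>M)" by (rule integral_nonneg_AE) (use bnd in auto)
qed

text \<open>A tail bound need hold only on [a, b]: g dominates the layer-cake density there, and its
  antiderivative G evaluates the integral in closed form.\<close>

lemma clamp_expectation_le: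
  fixes F f G g :: "real \<Rightarrow> real"
  assumes ab: "a \<le> b" and [measurable]: "F \<in> borel_measurable borel" "f \<in> borel_measurable borel" "g \<in> borel_measurable borel"
    and F: "\<And>u. a \<le> u \<Longrightarrow> u \<le> b \<Longrightarrow> (F has_real_derivative f u) (at u)"
    and f: "\<And>u. a \<le> u \<Longrightarrow> u \<le> b \<Longrightarrow> 0 \<le> f u"
    and G: "\<And>u. a \<le> u \<Longrightarrow> u \<le> b \<Longrightarrow> (G has_real_derivative g u) (at u)"
    and le: "\<And>u. a \<le> u \<Longrightarrow> u \<le> b \<Longrightarrow> f u * measure M {u..} \<le> g u"
  shows "(\<integral>x. F (min (max x a) b) - F a \<partial>M) \<le> G b - G a"
proof -
  have g: "0 \<le> g u" if "a \<le> u" "u \<le> b" for u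
    using le[OF that] f[OF that] by (meson measure_nonneg mult_nonneg_nonneg order_trans)
  have Gab: "G a \<le> G b"
    using ab by (intro DERIV_nonneg_imp_nondecreasing[of a b G]) (auto intro!: exI[of _ "g _"] G g)
  have "ennreal (\<integral>x. F (min (max x a) b) - F a \<partial>M) =
      (\<integral>\<^sup>+u. ennreal (f u * measure M {u..}) * indicator {a..b} u \<partial>lborel)"
    using nn_integral_clamp[of a b F f] layer_cake[of a b f F] ab F f by simp
  also have "\<dots> \<le> (\<integral>\<^sup>+u. ennreal (g u) * indicator {a..b} u \<partial>lborel)"
    using le by (intro nn_integral_mono) (auto split: split_indicator intro!: ennreal_leI)
  also have "\<dots> = ennreal (G b - G a)"
    using ab by (intro nn_integral_FTC_Icc G g) auto
  finally show ?thesis using Gab by (simp add: ennreal_le_iff)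
qed

lemma clamp_expectation_ge:
  fixes F f G g :: "real \<Rightarrow> real"
  assumes ab: "a \<le> b" and [measurable]: "F \<in> borel_measurable borel" "f \<in> borel_measurable borel" "g \<in> borel_measurable borel"
    and F: "\<And>u. a \<le> u \<Longrightarrow> u \<le> b \<Longrightarrow> (F has_real_derivative f u) (at u)"
    and f: "\<And>u. a \<le> u \<Longrightarrow> u \<le> b \<Longrightarrow> 0 \<le> f u"
    and G: "\<And>u. a \<le> u \<Longrightarrow> u \<le> b \<Longrightarrow> (G has_real_derivative g u) (at u)"
    and g: "\<And>u. a \<le> u \<Longrightarrow> u \<le> b \<Longrightarrow> 0 \<le> g u"
    and le: "\<And>u. a \<le> u \<Longrightarrow> u \<le> b \<Longrightarrow> g u \<le> f u * measure M {u..}"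
  shows "G b - G a \<le> (\<integral>x. F (min (max x a) b) - F a \<partial>M)"
proof -
  have "ennreal (G b - G a) = (\<integral>\<^sup>+u. ennreal (g u) * indicator {a..b} u \<partial>lborel)"
    using ab by (intro nn_integral_FTC_Icc[symmetric] G g) auto
  also have "\<dots> \<le> (\<integral>\<^sup>+u. ennreal (f u * measure M {u..}) * indicator {a..b} u \<partial>lborel)"
    using le by (intro nn_integral_mono) (auto split: split_indicator intro!: ennreal_leI)
  also have "\<dots> = ennreal (\<integral>x. F (min (max x a) b) - F a \<partial>M)"
    using nn_integral_clamp[of a b F f] layer_cake[of a b f F] ab F f by simp
  finally show ?thesis
    using integral_clamp_nonneg[of a b F f] ab F f by (simp add: ennreal_le_iff)
qed

section \<open>The truncated fourth moment and the size of D near zero\<close>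

definition trunc_fourth :: "real \<Rightarrow> real" where
  "trunc_fourth r = (\<integral>x. min \<bar>x\<bar> r ^ 4 \<partial>M)"

text \<open>The absolute value keeps the integrand below r^4 at every real x, whereas the weight is
  nonnegative only almost everywhere.\<close>

lemma integrable_trunc_fourth: "0 \<le> r \<Longrightarrow> integrable M (\<lambda>x. min \<bar>x\<bar> r ^ 4)"
  by (rule integrable_const_bound[of _ "r ^ 4"]) (auto intro!: power_mono)

lemma trunc_fourth_mono:
  assumes "0 \<le> r" "r \<le> s" shows "trunc_fourth r \<le> trunc_fourth s"
  unfolding trunc_fourth_def
  using assms by (intro integral_mono integrable_trunc_fourth power_mono) auto

lemma integrable_defect: "integrable M (\<lambda>x. x * tanh_defect (x * t))"
proof -
  have "integrable M (\<lambda>x. x * tanh (x * t + 0) - t * (x ^ 2 * (1 - tanh (x * t + 0) ^ 2)))"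
    by (intro Bochner_Integration.integrable_diff integrable_drive integrable_mult_right integrable_sech_moment) simp
  then show ?thesis by (simp add: tanh_defect_def algebra_simps power2_eq_square)
qed

lemma defect_mean_le: "0 \<le> t \<Longrightarrow> defect_mean t \<le> 2 * gap_mean t"
proof -
  assume t: "0 \<le> t"
  have "defect_mean t \<le> (\<integral>x. 2 * (x * tanh_gap (x * t)) \<partial>M)"
    unfolding defect_mean_def
  proof (rule integral_mono_AE[OF integrable_defect integrable_mult_right[OF integrable_gap]])
    show "AE x in M. x * tanh_defect (x * t) \<le> 2 * (x * tanh_gap (x * t))"
      using nonneg
    proof eventually_elim
      case (elim x)
      from mult_left_mono[OF tanh_defect_le_gap[of "x * t"] elim] show ?case using elim t by simp
    qed
  qed
  then show ?thesis by (simp add: gap_mean_def)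
qed

lemma defect_mean_lower:
  obtains c where "0 < c" and "\<And>t. 0 < t \<Longrightarrow> c * t ^ 3 * trunc_fourth (1 / t) \<le> defect_mean t"
proof -
  obtain c where c: "0 < c" "\<And>s. 0 \<le> s \<Longrightarrow> c * (min s 1) ^ 4 \<le> s * tanh_defect s"
    using tanh_defect_lower by blast
  have "c * t ^ 3 * trunc_fourth (1 / t) \<le> defect_mean t" if t: "0 < t" for t
  proof -
    have "(\<integral>x. c * t ^ 3 * min \<bar>x\<bar> (1 / t) ^ 4 \<partial>M) \<le> defect_mean t"
      unfolding defect_mean_def
    proof (rule integral_mono_AE[OF integrable_mult_right[OF integrable_trunc_fourth] integrable_defect])
      show "AE x in M. c * t ^ 3 * min \<bar>x\<bar> (1 / t) ^ 4 \<le> x * tanh_defect (x * t)"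
        using nonneg
      proof eventually_elim
        case (elim x)
        \<comment> \<open>Truncating W t at 1 is truncating W at 1/t; one of the resulting four
          factors t is cancelled below.\<close>
        have "min (x * t) 1 = t * min \<bar>x\<bar> (1 / t)"
          using t elim by (auto simp: min_def field_simps)
        then have "c * (t ^ 4 * min \<bar>x\<bar> (1 / t) ^ 4) \<le> x * t * tanh_defect (x * t)"
          using c(2)[of "x * t"] t elim by (simp add: power_mult_distrib)
        then have "t * (c * t ^ 3 * min \<bar>x\<bar> (1 / t) ^ 4) \<le> t * (x * tanh_defect (x * t))"
          by (simp add: eval_nat_numeral mult_ac)
        then show ?case using t by (rule mult_left_le_imp_le)
      qed
    qed (use t in simp)
    then show ?thesis by (simp add: trunc_fourth_def)
  qed
  then show ?thesis using that c(1) by blast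
qed

text \<open>The chain \<phi> \<lesssim> t^3 E[min(W, 1/t)^4] \<lesssim> \<open>defect_mean\<close>
  \<le> 2 \<open>gap_mean\<close> \<lesssim> \<phi> closes up, so a lower bound on the truncated
  moment and an upper bound on D settle both functions.\<close>

lemma gap_defect_bigtheta:
  assumes c: "0 < c" and ev: "\<forall>\<^sub>F t in at_right 0. 0 \<le> \<phi> t \<and> c * \<phi> t \<le> t ^ 3 * trunc_fourth (1 / t) \<and> gap_mean t \<le> C * \<phi> t"
  shows "gap_mean \<in> \<Theta>[at_right 0](\<phi>)" "defect_mean \<in> \<Theta>[at_right 0](\<phi>)"
proof -
  obtain b where b: "0 < b" "\<And>t. 0 < t \<Longrightarrow> b * t ^ 3 * trunc_fourth (1 / t) \<le> defect_mean t"
    using defect_mean_lower by blast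
  have bounds: "\<forall>\<^sub>F t in at_right 0. 0 \<le> \<phi> t \<and> b * c * \<phi> t \<le> defect_mean t \<and> defect_mean t \<le> 2 * gap_mean t \<and> gap_mean t \<le> C * \<phi> t"
    using ev eventually_at_right_less[of 0]
  proof eventually_elim
    case (elim t)
    have "b * (c * \<phi> t) \<le> b * (t ^ 3 * trunc_fourth (1 / t))"
      using elim b by (intro mult_left_mono) auto
    then show ?case using b(2)[of t] defect_mean_le[of t] elim by (simp add: mult_ac)
  qed
  show "gap_mean \<in> \<Theta>[at_right 0](\<phi>)"
    by (rule bigtheta_sandwich[where c = "b * c / 2" and C = C])
       (use b c in simp, use bounds in eventually_elim, simp)
  show "defect_mean \<in> \<Theta>[at_right 0](\<phi>)"
    by (rule bigtheta_sandwich[where c = "b * c" and C = "2 * C"])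
       (use b c in simp, use bounds in eventually_elim, simp)
qed

lemma fourth_moment_bigtheta:
  assumes int: "integrable M (\<lambda>x. x ^ 4)"
  shows "gap_mean \<in> \<Theta>[at_right 0](\<lambda>t. t powr 3)" "defect_mean \<in> \<Theta>[at_right 0](\<lambda>t. t powr 3)"
proof -
  have c: "0 < trunc_fourth 1"
    unfolding trunc_fourth_def by (rule expectation_pos[OF integrable_trunc_fourth]) auto
  have "\<forall>\<^sub>F t in at_right 0. 0 < t \<and> t < (1::real)"
    by (auto simp: eventually_at_right_field intro!: exI[of _ 1])
  then have "\<forall>\<^sub>F t in at_right 0. 0 \<le> t powr 3 \<and> trunc_fourth 1 * t powr 3 \<le> t ^ 3 * trunc_fourth (1 / t) \<and>
      gap_mean t \<le> (\<integral>x. x ^ 4 \<partial>M) * t powr 3"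
  proof eventually_elim
    case (elim t)
    \<comment> \<open>For t < 1 the truncation level exceeds 1, so a fixed positive constant bounds
      the moment from below.\<close>
    have "trunc_fourth 1 \<le> trunc_fourth (1 / t)"
      using elim by (intro trunc_fourth_mono) auto
    moreover have "gap_mean t \<le> (\<integral>x. t ^ 3 * x ^ 4 \<partial>M)"
      unfolding gap_mean_def
    proof (rule integral_mono_AE[OF integrable_gap integrable_mult_right[OF int]])
      show "AE x in M. x * tanh_gap (x * t) \<le> t ^ 3 * x ^ 4"
        using nonneg
      proof eventually_elim
        case (elim x)
        from mult_left_mono[OF tanh_gap_le_cube[of "x * t"] elim] show ?case
          using elim \<open>0 < t \<and> t < 1\<close> by (simp add: power_mult_distrib eval_nat_numeral mult_ac)
      qed
    qed
    ultimately show ?case using elim by (simp add: powr_numeral mult.commute)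
  qed
  from gap_defect_bigtheta[OF c this]
  show "gap_mean \<in> \<Theta>[at_right 0](\<lambda>t. t powr 3)" "defect_mean \<in> \<Theta>[at_right 0](\<lambda>t. t powr 3)" by auto
qed

lemma power_law_tail:
  assumes "power_law M \<tau>"
  obtains c C a where "0 < c" "0 < C" "1 < a"
    and "\<And>u. a \<le> u \<Longrightarrow> c * u powr (1 - \<tau>) \<le> measure M {u..}"
    and "\<And>u. a \<le> u \<Longrightarrow> measure M {u..} \<le> C * u powr (1 - \<tau>)"
proof -
  obtain c C w0 where h: "0 < c" "c < C" "1 < w0"
    and lo: "\<And>w. w0 < w \<Longrightarrow> c * w powr (1 - \<tau>) \<le> measure M {x. w < x}"
    and up: "\<And>w. w0 < w \<Longrightarrow> measure M {x. w < x} \<le> C * w powr (1 - \<tau>)"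
    using assms unfolding power_law_def by (auto simp: minus_diff_eq)
  show ?thesis
  \<comment> \<open>The hypothesis concerns open tails, the layer-cake formula closed ones. The
    closed tail at u lies in the open tail at u/2, which costs the factor (1/2)^(1-\<tau>); u \<ge>
    3 w0 keeps u/2 above w0.\<close>
  proof (rule that[of c "C * (1 / 2) powr (1 - \<tau>)" "3 * w0"])
    fix u assume u: "3 * w0 \<le> u"
    have "c * u powr (1 - \<tau>) \<le> measure M {x. u < x}" using u h by (intro lo) auto
    also have "\<dots> \<le> measure M {u..}" by (intro finite_measure_mono) auto
    finally show "c * u powr (1 - \<tau>) \<le> measure M {u..}" .
    have "measure M {u..} \<le> measure M {x. u / 2 < x}"
      using u h by (intro finite_measure_mono) auto
    also have "\<dots> \<le> C * (u * (1 / 2)) powr (1 - \<tau>)" using u h up[of "u / 2"] by simp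
    also have "\<dots> = C * (1 / 2) powr (1 - \<tau>) * u powr (1 - \<tau>)"
      using u h by (subst powr_mult) auto
    finally show "measure M {u..} \<le> C * (1 / 2) powr (1 - \<tau>) * u powr (1 - \<tau>)" .
  qed (use h in auto)
qed

text \<open>The bounds s^3 and s for the gap meet at s = 1, that is at x = 1/t. Beyond it t x^2 is
  split as t (1/t)^2, which equals t^3 (1/t)^4, plus t times the excess of x^2 over (1/t)^2.\<close>

lemma gap_mean_le_trunc:
  assumes t: "0 < t"
  shows "gap_mean t \<le> t ^ 3 * trunc_fourth (1 / t) + t * (\<integral>x. max (x\<^sup>2 - (1 / t)\<^sup>2) 0 \<partial>M)"
proof -
  have int: "integrable M (\<lambda>x. max (x\<^sup>2 - (1 / t)\<^sup>2) 0)"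
    by (rule Bochner_Integration.integrable_bound[OF integrable_sq]) (auto intro!: AE_I2)
  have "gap_mean t \<le> (\<integral>x. t ^ 3 * min \<bar>x\<bar> (1 / t) ^ 4 + t * max (x\<^sup>2 - (1 / t)\<^sup>2) 0 \<partial>M)"
    unfolding gap_mean_def
  proof (rule integral_mono_AE[OF integrable_gap])
    show "integrable M (\<lambda>x. t ^ 3 * min \<bar>x\<bar> (1 / t) ^ 4 + t * max (x\<^sup>2 - (1 / t)\<^sup>2) 0)"
      using t by (intro Bochner_Integration.integrable_add integrable_mult_right int integrable_trunc_fourth) auto
    show "AE x in M. x * tanh_gap (x * t) \<le> t ^ 3 * min \<bar>x\<bar> (1 / t) ^ 4 + t * max (x\<^sup>2 - (1 / t)\<^sup>2) 0"
      using nonneg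
    proof eventually_elim
      case (elim x)
      show ?case
      proof (cases "x \<le> 1 / t")
        case True
        have "x * tanh_gap (x * t) \<le> x * (x * t) ^ 3"
          using elim t by (intro mult_left_mono tanh_gap_le_cube) auto
        also have "\<dots> = t ^ 3 * min \<bar>x\<bar> (1 / t) ^ 4"
          using True elim by (simp add: min_def power_mult_distrib eval_nat_numeral mult_ac)
        also have "\<dots> \<le> \<dots> + t * max (x\<^sup>2 - (1 / t)\<^sup>2) 0" using t by simp
        finally show ?thesis .
      next
        case False
        have "(1 / t)\<^sup>2 \<le> x\<^sup>2" using False t by (intro power_mono) auto
        then have eq: "t ^ 3 * min \<bar>x\<bar> (1 / t) ^ 4 + t * max (x\<^sup>2 - (1 / t)\<^sup>2) 0 = t * x\<^sup>2"
          using False t elim by (simp add: min_def max_def field_simps eval_nat_numeral)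
        have "x * tanh_gap (x * t) \<le> x * (x * t)"
          using elim t by (intro mult_left_mono tanh_gap_le_self) auto
        then show ?thesis unfolding eq by (simp add: power2_eq_square mult_ac)
      qed
    qed
  qed
  also have "\<dots> = t ^ 3 * trunc_fourth (1 / t) + t * (\<integral>x. max (x\<^sup>2 - (1 / t)\<^sup>2) 0 \<partial>M)"
    using t int integrable_trunc_fourth[of "1 / t"] by (simp add: trunc_fourth_def)
  finally show ?thesis .
qed

text \<open>The tail bound times 2 u has order u^(2-\<tau>), with an antiderivative that decays
  because \<tau> > 3. The estimate is made on [r, r + n], uniformly in n, and n tends to infinity
  under the dominating function x^2.\<close>

lemma tail_second_moment:
  assumes up: "\<And>u. a \<le> u \<Longrightarrow> measure M {u..} \<le> C * u powr (1 - \<tau>)"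
    and r: "0 < a" "a \<le> r" and \<tau>: "3 < \<tau>" and C: "0 < C"
  shows "(\<integral>x. max (x\<^sup>2 - r\<^sup>2) 0 \<partial>M) \<le> 2 * C / (\<tau> - 3) * r powr (3 - \<tau>)"
proof (rule LIMSEQ_le_const2)
  let ?G = "\<lambda>u. - (2 * C / (\<tau> - 3)) * u powr (3 - \<tau>)"
  have bound: "(\<integral>x. (min (max x r) b)\<^sup>2 - r\<^sup>2 \<partial>M) \<le> 2 * C / (\<tau> - 3) * r powr (3 - \<tau>)" if b: "r \<le> b" for b
  proof -
    have "(\<integral>x. (min (max x r) b)\<^sup>2 - r\<^sup>2 \<partial>M) \<le> ?G b - ?G r"
    proof (rule clamp_expectation_le[OF b, where f = "\<lambda>u. 2 * u" and g = "\<lambda>u. 2 * C * u powr (2 - \<tau>)"])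
      fix u assume u: "r \<le> u" "u \<le> b"
      have u0: "0 < u" using r u by simp
      show "((\<lambda>u. u\<^sup>2) has_real_derivative 2 * u) (at u)" by (auto intro!: derivative_eq_intros)
      show "0 \<le> 2 * u" using u0 by simp
      have "(?G has_real_derivative - (2 * C / (\<tau> - 3)) * ((3 - \<tau>) * u powr (3 - \<tau> - 1))) (at u)"
        by (intro DERIV_cmult has_real_derivative_powr u0)
      also have "- (2 * C / (\<tau> - 3)) * ((3 - \<tau>) * u powr (3 - \<tau> - 1)) = 2 * C * u powr (2 - \<tau>)"
        using \<tau> by (simp add: field_simps)
      finally show "(?G has_real_derivative 2 * C * u powr (2 - \<tau>)) (at u)" .
      have "2 * u * measure M {u..} \<le> 2 * u * (C * u powr (1 - \<tau>))"
        using u0 u r by (intro mult_left_mono up) auto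
      also have "\<dots> = 2 * C * u powr (2 - \<tau>)"
        using u0 powr_add[of u 1 "1 - \<tau>"] by (simp add: algebra_simps)
      finally show "2 * u * measure M {u..} \<le> 2 * C * u powr (2 - \<tau>)" .
    qed auto
    also have "\<dots> \<le> 2 * C / (\<tau> - 3) * r powr (3 - \<tau>)"
      using C \<tau> by simp
    finally show ?thesis .
  qed
  show "(\<lambda>n. \<integral>x. (min (max x r) (r + real n))\<^sup>2 - r\<^sup>2 \<partial>M) \<longlonglongrightarrow> (\<integral>x. max (x\<^sup>2 - r\<^sup>2) 0 \<partial>M)"
  proof (rule integral_dominated_convergence[where w = "\<lambda>x. x\<^sup>2"])
    show "AE x in M. (\<lambda>n. (min (max x r) (r + real n))\<^sup>2 - r\<^sup>2) \<longlonglongrightarrow> max (x\<^sup>2 - r\<^sup>2) 0"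
      using nonneg
    proof eventually_elim
      case (elim x)
      have "\<forall>\<^sub>F n in sequentially. x - r \<le> real n"
        using filterlim_real_sequentially by (simp add: filterlim_at_top)
      then have "\<forall>\<^sub>F n in sequentially. max (x\<^sup>2 - r\<^sup>2) 0 = (min (max x r) (r + real n))\<^sup>2 - r\<^sup>2"
      proof eventually_elim
        case (elim n)
        show ?case
        proof (cases "x \<le> r")
          case True
          then have "x\<^sup>2 \<le> r\<^sup>2" using \<open>0 \<le> x\<close> by (intro power_mono) auto
          then show ?thesis using True by (simp add: max_def min_def)
        next
          case False
          then have "r\<^sup>2 \<le> x\<^sup>2" using r by (intro power_mono) auto
          then show ?thesis using False elim by (simp add: max_def min_def)
        qed
      qed
      then show ?case by (rule tendsto_eventually[OF eventually_mono]) simp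
    qed
    show "AE x in M. norm ((min (max x r) (r + real n))\<^sup>2 - r\<^sup>2) \<le> x\<^sup>2" for n
    proof (rule AE_I2)
      fix x :: real
      have "r\<^sup>2 \<le> (min (max x r) (r + real n))\<^sup>2" using r by (intro power_mono) auto
      moreover have "(min (max x r) (r + real n))\<^sup>2 \<le> (max x r)\<^sup>2" using r by (intro power_mono) auto
      moreover have "(max x r)\<^sup>2 \<le> x\<^sup>2 + r\<^sup>2" by (simp add: max_def)
      ultimately show "norm ((min (max x r) (r + real n))\<^sup>2 - r\<^sup>2) \<le> x\<^sup>2" by simp
    qed
  qed (auto intro: integrable_sq)
  show "\<exists>N. \<forall>n\<ge>N. (\<integral>x. (min (max x r) (r + real n))\<^sup>2 - r\<^sup>2 \<partial>M) \<le> 2 * C / (\<tau> - 3) * r powr (3 - \<tau>)"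
    using bound by auto
qed

text \<open>The tail estimates start at a, so the part of the weight below a is paid for by the
  constant a^4.\<close>

lemma trunc_fourth_clamp_upper:
  assumes "0 \<le> a" "a \<le> r"
  shows "trunc_fourth r \<le> a ^ 4 + (\<integral>x. (min (max x a) r) ^ 4 - a ^ 4 \<partial>M)"
proof -
  have int: "integrable M (\<lambda>x. (min (max x a) r) ^ 4 - a ^ 4)"
    by (rule integrable_clamp[where f = "\<lambda>u. 4 * u ^ 3"])
       (use assms in \<open>auto intro!: derivative_eq_intros\<close>)
  have "trunc_fourth r \<le> (\<integral>x. a ^ 4 + ((min (max x a) r) ^ 4 - a ^ 4) \<partial>M)"
    unfolding trunc_fourth_def
  proof (rule integral_mono_AE)
    show "AE x in M. min \<bar>x\<bar> r ^ 4 \<le> a ^ 4 + ((min (max x a) r) ^ 4 - a ^ 4)"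
      using nonneg by eventually_elim (use assms in \<open>auto intro!: power_mono\<close>)
    show "integrable M (\<lambda>x. a ^ 4 + ((min (max x a) r) ^ 4 - a ^ 4))"
      by (rule Bochner_Integration.integrable_add[OF integrable_const int])
  qed (use assms int in \<open>auto intro!: integrable_trunc_fourth\<close>)
  also have "\<dots> = a ^ 4 + (\<integral>x. (min (max x a) r) ^ 4 - a ^ 4 \<partial>M)"
    using int by (subst Bochner_Integration.integral_add) (auto simp: prob_space[simplified])
  finally show ?thesis .
qed

lemma trunc_fourth_clamp_lower:
  assumes "0 \<le> a" "a \<le> r"
  shows "(\<integral>x. (min (max x a) r) ^ 4 - a ^ 4 \<partial>M) \<le> trunc_fourth r"
  unfolding trunc_fourth_def
proof (rule integral_mono_AE)
  show "integrable M (\<lambda>x. (min (max x a) r) ^ 4 - a ^ 4)"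
    by (rule integrable_clamp[where f = "\<lambda>u. 4 * u ^ 3"])
       (use assms in \<open>auto intro!: derivative_eq_intros\<close>)
  show "AE x in M. (min (max x a) r) ^ 4 - a ^ 4 \<le> min \<bar>x\<bar> r ^ 4"
    using nonneg
  proof eventually_elim
    case (elim x)
    have "a ^ 4 \<ge> 0" using assms by simp
    then show ?case using assms elim by (cases "x \<le> a") (auto simp: max_def min_def)
  qed
qed (use assms in \<open>auto intro!: integrable_trunc_fourth\<close>)

lemma power_law_bigtheta:
  assumes pl: "power_law M \<tau>" and \<tau>: "3 < \<tau>" "\<tau> < 5"
  shows "gap_mean \<in> \<Theta>[at_right 0](\<lambda>t. t powr (\<tau> - 2))" "defect_mean \<in> \<Theta>[at_right 0](\<lambda>t. t powr (\<tau> - 2))"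
proof -
  obtain c C a where c: "0 < c" "0 < C" "1 < a"
    and lo: "\<And>u. a \<le> u \<Longrightarrow> c * u powr (1 - \<tau>) \<le> measure M {u..}"
    and up: "\<And>u. a \<le> u \<Longrightarrow> measure M {u..} \<le> C * u powr (1 - \<tau>)"
    using power_law_tail[OF pl] by blast
  let ?K = "a ^ 4 + 4 * C / (5 - \<tau>)"
  \<comment> \<open>The single event W \<ge> r already gives the right order: r^4 times its
    probability is at least c r^(5-\<tau>).\<close>
  have lower: "c * r powr (5 - \<tau>) \<le> trunc_fourth r" if r: "a \<le> r" for r
  proof -
    have "c * r powr (5 - \<tau>) = r ^ 4 * (c * r powr (1 - \<tau>))"
      using r c powr_add[of r 4 "1 - \<tau>"] by (simp add: powr_numeral)
    also have "\<dots> \<le> r ^ 4 * measure M {r..}" using r c by (intro mult_left_mono lo) auto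
    also have "\<dots> = (\<integral>x. r ^ 4 * indicator {r..} x \<partial>M)" by simp
    also have "\<dots> \<le> trunc_fourth r"
      unfolding trunc_fourth_def using r c
      by (intro integral_mono integrable_trunc_fourth integrable_mult_right integrable_real_indicator)
         (auto split: split_indicator simp: emeasure_eq_measure)
    finally show ?thesis .
  qed
  have upper: "trunc_fourth r \<le> ?K * r powr (5 - \<tau>)" if r: "a \<le> r" for r
  proof -
    let ?G = "\<lambda>u. 4 * C / (5 - \<tau>) * u powr (5 - \<tau>)"
    have "(\<integral>x. (min (max x a) r) ^ 4 - a ^ 4 \<partial>M) \<le> ?G r - ?G a"
    proof (rule clamp_expectation_le[OF r, where f = "\<lambda>u. 4 * u ^ 3" and g = "\<lambda>u. 4 * C * u powr (4 - \<tau>)"])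
      fix u assume u: "a \<le> u" "u \<le> r"
      have u0: "0 < u" using c u by simp
      show "((\<lambda>u. u ^ 4) has_real_derivative 4 * u ^ 3) (at u)" by (auto intro!: derivative_eq_intros)
      show "0 \<le> 4 * u ^ 3" using u0 by simp
      have "(?G has_real_derivative (4 * C / (5 - \<tau>)) * ((5 - \<tau>) * u powr (5 - \<tau> - 1))) (at u)"
        by (intro DERIV_cmult has_real_derivative_powr u0)
      then show "(?G has_real_derivative 4 * C * u powr (4 - \<tau>)) (at u)" using \<tau> by (simp add: mult.assoc)
      have "4 * u ^ 3 * measure M {u..} \<le> 4 * u ^ 3 * (C * u powr (1 - \<tau>))"
        using u0 u by (intro mult_left_mono up) auto
      also have "\<dots> = 4 * C * u powr (4 - \<tau>)"
        using u0 powr_add[of u 3 "1 - \<tau>"] by (simp add: powr_numeral)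
      finally show "4 * u ^ 3 * measure M {u..} \<le> 4 * C * u powr (4 - \<tau>)" .
    qed auto
    also have "\<dots> \<le> ?G r" using c \<tau> by simp
    finally have "trunc_fourth r \<le> a ^ 4 + ?G r" using trunc_fourth_clamp_upper[of a r] r c by simp
    \<comment> \<open>The constant a^4 is absorbed, since r \<ge> 1 and \<tau> < 5 make r^(5-\<tau>)
      at least 1.\<close>
    moreover have "a ^ 4 * 1 \<le> a ^ 4 * r powr (5 - \<tau>)"
      using c r \<tau> by (intro mult_left_mono ge_one_powr_ge_zero) auto
    ultimately show ?thesis by (simp add: algebra_simps)
  qed
  have "\<forall>\<^sub>F t in at_right 0. 0 < t \<and> t < 1 / a"
    using c by (auto simp: eventually_at_right_field intro!: exI[of _ "1 / a"])
  then have "\<forall>\<^sub>F t in at_right 0. 0 \<le> t powr (\<tau> - 2) \<and>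
      c * t powr (\<tau> - 2) \<le> t ^ 3 * trunc_fourth (1 / t) \<and> gap_mean t \<le> (?K + 2 * C / (\<tau> - 3)) * t powr (\<tau> - 2)"
  proof eventually_elim
    case (elim t)
    have r: "a \<le> 1 / t" using elim c by (simp add: field_simps)
    have e1: "t ^ 3 * (1 / t) powr (5 - \<tau>) = t powr (\<tau> - 2)"
      using elim powr_add[of t 3 "\<tau> - 5"] by (simp add: powr_divide powr_numeral flip: powr_minus_divide)
    have e2: "t * (1 / t) powr (3 - \<tau>) = t powr (\<tau> - 2)"
      using elim powr_add[of t 1 "\<tau> - 3"] by (simp add: powr_divide flip: powr_minus_divide)
    have "t ^ 3 * (c * (1 / t) powr (5 - \<tau>)) \<le> t ^ 3 * trunc_fourth (1 / t)"
      using elim by (intro mult_left_mono lower[OF r]) auto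
    then have 1: "c * t powr (\<tau> - 2) \<le> t ^ 3 * trunc_fourth (1 / t)"
      unfolding e1[symmetric] by (simp add: mult_ac)
    have "t ^ 3 * trunc_fourth (1 / t) \<le> t ^ 3 * (?K * (1 / t) powr (5 - \<tau>))"
      using elim by (intro mult_left_mono upper[OF r]) auto
    also have "\<dots> = ?K * t powr (\<tau> - 2)" unfolding e1[symmetric] by (simp only: mult_ac)
    finally have 2: "t ^ 3 * trunc_fourth (1 / t) \<le> ?K * t powr (\<tau> - 2)" .
    have "t * (\<integral>x. max (x\<^sup>2 - (1 / t)\<^sup>2) 0 \<partial>M) \<le> t * (2 * C / (\<tau> - 3) * (1 / t) powr (3 - \<tau>))"
      using elim c \<tau> r by (intro mult_left_mono tail_second_moment[OF up]) auto
    also have "\<dots> = 2 * C / (\<tau> - 3) * t powr (\<tau> - 2)" unfolding e2[symmetric] by (simp only: mult_ac)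
    finally have "gap_mean t \<le> ?K * t powr (\<tau> - 2) + 2 * C / (\<tau> - 3) * t powr (\<tau> - 2)"
      using gap_mean_le_trunc[of t] elim 2 by linarith
    then show ?case using 1 by (simp only: distrib_right) simp
  qed
  from gap_defect_bigtheta[OF c(1) this]
  show "gap_mean \<in> \<Theta>[at_right 0](\<lambda>t. t powr (\<tau> - 2))" "defect_mean \<in> \<Theta>[at_right 0](\<lambda>t. t powr (\<tau> - 2))" by auto
qed

text \<open>The density 4 u^3 times a tail of order u^(-4) is of order 1/u: every scale between a
  and 1/t contributes equally, which produces the logarithm. The lower bound must therefore also
  integrate over all scales.\<close>

lemma power_law_five_bigtheta:
  assumes pl: "power_law M 5"
  shows "gap_mean \<in> \<Theta>[at_right 0](\<lambda>t. t powr 3 * ln (1 / t))"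
proof -
  obtain c C a where c: "0 < c" "0 < C" "1 < a"
    and lo: "\<And>u. a \<le> u \<Longrightarrow> c * u powr (1 - 5) \<le> measure M {u..}"
    and up: "\<And>u. a \<le> u \<Longrightarrow> measure M {u..} \<le> C * u powr (1 - 5)"
    using power_law_tail[OF pl] by blast
  have cube: "4 * u ^ 3 * (d * u powr (1 - 5)) = 4 * d / u" if "0 < u" for u d :: real
  proof -
    have "u powr (1 - 5) = 1 / u ^ 4" using that by (simp add: powr_minus_divide powr_numeral)
    then show ?thesis using that by (simp add: field_simps eval_nat_numeral)
  qed
  have D: "((\<lambda>u. 4 * d * ln u) has_real_derivative 4 * d / u) (at u)" if "0 < u" for u d :: real
    using that by (auto intro!: derivative_eq_intros)
  have F: "((\<lambda>u. u ^ 4) has_real_derivative 4 * u ^ 3) (at u)" for u :: real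
    by (auto intro!: derivative_eq_intros)
  have lower: "4 * c * (ln r - ln a) \<le> trunc_fourth r" if r: "a \<le> r" for r
  proof -
    have "4 * c * ln r - 4 * c * ln a \<le> (\<integral>x. (min (max x a) r) ^ 4 - a ^ 4 \<partial>M)"
    proof (rule clamp_expectation_ge[OF r, where f = "\<lambda>u. 4 * u ^ 3" and g = "\<lambda>u. 4 * c / u"])
      fix u assume u: "a \<le> u" "u \<le> r"
      have "4 * c / u = 4 * u ^ 3 * (c * u powr (1 - 5))"
        using u c by (intro cube[symmetric]) auto
      also have "\<dots> \<le> 4 * u ^ 3 * measure M {u..}"
        using u c by (intro mult_left_mono lo) auto
      finally show "4 * c / u \<le> 4 * u ^ 3 * measure M {u..}" .
    qed (use c in \<open>auto intro!: F D\<close>)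
    then show ?thesis using trunc_fourth_clamp_lower[of a r] r c by (simp add: algebra_simps)
  qed
  have upper: "trunc_fourth r \<le> a ^ 4 + 4 * C * ln r" if r: "a \<le> r" for r
  proof -
    have "(\<integral>x. (min (max x a) r) ^ 4 - a ^ 4 \<partial>M) \<le> 4 * C * ln r - 4 * C * ln a"
    proof (rule clamp_expectation_le[OF r, where f = "\<lambda>u. 4 * u ^ 3" and g = "\<lambda>u. 4 * C / u"])
      fix u assume u: "a \<le> u" "u \<le> r"
      have "4 * u ^ 3 * measure M {u..} \<le> 4 * u ^ 3 * (C * u powr (1 - 5))"
        using u c by (intro mult_left_mono up) auto
      also have "\<dots> = 4 * C / u" using u c by (intro cube) auto
      finally show "4 * u ^ 3 * measure M {u..} \<le> 4 * C / u" .
    qed (use c in \<open>auto intro!: F D\<close>)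
    moreover have "0 \<le> 4 * C * ln a" using c by simp
    moreover have "trunc_fourth r \<le> a ^ 4 + (\<integral>x. (min (max x a) r) ^ 4 - a ^ 4 \<partial>M)"
      using r c by (intro trunc_fourth_clamp_upper) auto
    ultimately show ?thesis by linarith
  qed
  let ?K = "a ^ 4 + 4 * C + C"
  \<comment> \<open>Below 1/a^2 the subtracted ln a is at most half of ln (1/t), which turns the
    constant 4 c into 2 c. Below 1/e one has ln (1/t) \<ge> 1, so a^4 and the tail term C t^2 are
    absorbed into the logarithm.\<close>
  have "\<forall>\<^sub>F t in at_right 0. 0 < t \<and> t < min (1 / a ^ 2) (1 / exp 1)"
    using c by (intro eventually_conj eventually_at_right_less eventually_at_rightI[of 0 "min (1 / a ^ 2) (1 / exp 1)"]) auto
  then have "\<forall>\<^sub>F t in at_right 0. 0 \<le> t powr 3 * ln (1 / t) \<and>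
      2 * c * (t powr 3 * ln (1 / t)) \<le> t ^ 3 * trunc_fourth (1 / t) \<and> gap_mean t \<le> ?K * (t powr 3 * ln (1 / t))"
  proof eventually_elim
    case (elim t)
    have r2: "a ^ 2 \<le> 1 / t" using elim c by (simp add: field_simps)
    have "a * 1 \<le> a * a" using c by (intro mult_left_mono) auto
    then have r: "a \<le> 1 / t" using r2 by (simp add: power2_eq_square)
    have "ln (a ^ 2) \<le> ln (1 / t)" using r2 c elim by (intro ln_mono) auto
    then have la: "2 * ln a \<le> ln (1 / t)" using c by (simp add: ln_realpow)
    have "ln (exp 1) \<le> ln (1 / t)" using elim by (intro ln_mono) (auto simp: field_simps)
    then have l1: "1 \<le> ln (1 / t)" by simp
    have t3: "t powr 3 = t ^ 3" using elim by (simp add: powr_numeral)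
    have "2 * c * ln (1 / t) \<le> trunc_fourth (1 / t)"
    proof -
      have "c * (2 * ln a) \<le> c * ln (1 / t)" using la c by (intro mult_left_mono) auto
      moreover have "4 * (c * ln (1 / t)) - 2 * (c * (2 * ln a)) \<le> trunc_fourth (1 / t)"
        using lower[OF r] by (simp add: algebra_simps)
      ultimately show ?thesis by linarith
    qed
    then have "t ^ 3 * (2 * c * ln (1 / t)) \<le> t ^ 3 * trunc_fourth (1 / t)"
      using elim by (intro mult_left_mono) auto
    then have 1: "2 * c * (t powr 3 * ln (1 / t)) \<le> t ^ 3 * trunc_fourth (1 / t)"
      unfolding t3 by (simp only: mult_ac)
    have "a ^ 4 * 1 \<le> a ^ 4 * ln (1 / t)" using l1 c by (intro mult_left_mono) auto
    then have "trunc_fourth (1 / t) \<le> (a ^ 4 + 4 * C) * ln (1 / t)"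
      using upper[OF r] by (simp add: distrib_right)
    then have 2: "t ^ 3 * trunc_fourth (1 / t) \<le> t ^ 3 * ((a ^ 4 + 4 * C) * ln (1 / t))"
      using elim by (intro mult_left_mono) auto
    have "(\<integral>x. max (x\<^sup>2 - (1 / t)\<^sup>2) 0 \<partial>M) \<le> 2 * C / (5 - 3) * (1 / t) powr (3 - 5)"
      using c r by (intro tail_second_moment[OF up]) auto
    also have "\<dots> = C * t ^ 2" using elim by (simp add: powr_minus_divide powr_numeral power_divide)
    also have "\<dots> \<le> C * t ^ 2 * ln (1 / t)"
      using mult_left_mono[OF l1, of "C * t ^ 2"] c by simp
    finally have "t * (\<integral>x. max (x\<^sup>2 - (1 / t)\<^sup>2) 0 \<partial>M) \<le> t * (C * t ^ 2 * ln (1 / t))"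
      using elim by (intro mult_left_mono) auto
    then have "gap_mean t \<le> t ^ 3 * ((a ^ 4 + 4 * C) * ln (1 / t)) + t * (C * t ^ 2 * ln (1 / t))"
      using gap_mean_le_trunc[of t] elim 2 by linarith
    also have "\<dots> = ?K * (t powr 3 * ln (1 / t))"
      unfolding t3 by (simp add: algebra_simps eval_nat_numeral)
    finally show ?case using 1 l1 by simp
  qed
  from gap_defect_bigtheta(1)[OF _ this] show ?thesis using c by simp
qed

end

section \<open>Nonnegativity of the limit law, and conclusion\<close>

lemma weight_regular_imp_weight_law:
  assumes "weight_regular w M" shows "weight_law M"
proof -
  have w: "\<And>N i. i < N \<Longrightarrow> 0 < w N i" and M: "real_distribution M"
    and conv: "weak_conv_m (emp_law w) M" and sq: "integrable M (\<lambda>x. x\<^sup>2)" and EW: "0 < EW M"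
    using assms by (auto simp: weight_regular_def)
  interpret real_distribution M by (rule M)
  \<comment> \<open>N > 0 is required because \<open>pmf_of_set\<close> carries no information on
    the empty set; the limit sees only large N.\<close>
  have emp: "cdf (emp_law w N) x = 0" if "0 < N" "x < 0" for N x
  proof -
    have "set_pmf (pmf_of_set {..<N}) = {..<N}" using that by (intro set_pmf_of_set) auto
    then show ?thesis
      using w[of _ N] that unfolding cdf_def emp_law_def by (fastforce simp: measure_pmf_zero_iff)
  qed
  \<comment> \<open>Weak convergence passes to the limit only at continuity points of the
    distribution function. The discontinuities are countable, so a continuity point y lies in (x,
    0), and monotonicity carries the value 0 from y down to x.\<close>
  have zero: "cdf M x = 0" if x: "x < 0" for x
  proof -
    have "countable {y. \<not> isCont (cdf M) y}"
      by (rule mono_ctble_discont) (auto intro!: monoI cdf_nondecreasing)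
    then have "\<not> {x<..<0} \<subseteq> {y. \<not> isCont (cdf M) y}"
      using x uncountable_open_interval[of x 0] countable_subset by blast
    then obtain y where y: "x < y" "y < 0" "isCont (cdf M) y" by auto
    have "(\<lambda>N. cdf (emp_law w N) y) \<longlonglongrightarrow> cdf M y"
      using conv y unfolding weak_conv_m_def weak_conv_def by auto
    moreover have "(\<lambda>N. cdf (emp_law w N) y) \<longlonglongrightarrow> 0"
      by (rule tendsto_eventually) (use eventually_gt_at_top[of 0] in eventually_elim, simp add: emp y)
    ultimately have "cdf M y = 0" by (rule LIMSEQ_unique)
    then show ?thesis using cdf_nondecreasing[of x y] cdf_nonneg[of x] y by simp
  qed
  have "AE x in M. x \<notin> {..- inverse (real (Suc n))}" for n
    using zero[of "- inverse (real (Suc n))"] by (simp add: cdf_def prob_eq_0)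
  then have "AE x in M. \<forall>n. x \<notin> {..- inverse (real (Suc n))}" by (simp add: AE_all_countable)
  then have "AE x in M. 0 \<le> x"
  proof eventually_elim
    case (elim x)
    show ?case
    proof (rule ccontr)
      assume "\<not> 0 \<le> x"
      then obtain n where "inverse (real (Suc n)) < - x" using reals_Archimedean[of "- x"] by auto
      then show False using elim by (auto simp: not_le dest!: spec[of _ n])
    qed
  qed
  then show ?thesis using sq EW M by (simp add: weight_law_def weight_law_axioms_def)
qed

theorem mainTheorem1:
  fixes w :: "nat \<Rightarrow> nat \<Rightarrow> real" and M :: "real measure"
  assumes "weight_regular w M"
  shows "(integrable M (\<lambda>x. x ^ 4) \<longrightarrow>
            has_crit_exps M sinh (arsinh (1 / nu M)) (1/2) 3 1 1 \<and>
            has_crit_exps M (\<lambda>b. b) (1 / nu M) (1/2) 3 1 1) \<and>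
         (\<forall>\<tau>. power_law M \<tau> \<and> 3 < \<tau> \<and> \<tau> < 5 \<longrightarrow>
            has_crit_exps M sinh (arsinh (1 / nu M)) (1 / (\<tau> - 3)) (\<tau> - 2) 1 1 \<and>
            has_crit_exps M (\<lambda>b. b) (1 / nu M) (1 / (\<tau> - 3)) (\<tau> - 2) 1 1) \<and>
         (power_law M 5 \<longrightarrow>
            boundary_behaviour M sinh (arsinh (1 / nu M)) \<and>
            boundary_behaviour M (\<lambda>b. b) (1 / nu M))"
proof -
  interpret weight_law M by (rule weight_regular_imp_weight_law[OF assms])
  \<comment> \<open>E[W] cancels in 1/(\<nu> E[W]), leaving 1/E[W^2]: both critical values of
    \<beta> correspond to the same \<theta>.\<close>
  have nu: "1 / nu M / EW M = crit"
    using mean_pos by (simp add: nu_def crit_def second_moment_def)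
  have sinh: "(sinh has_real_derivative cosh (arsinh (1 / nu M))) (at (arsinh (1 / nu M)))"
    "0 < cosh (arsinh (1 / nu M))" "sinh (arsinh (1 / nu M)) / EW M = crit"
    using nu by (auto intro!: derivative_eq_intros)
  have id: "((\<lambda>b. b) has_real_derivative 1) (at (1 / nu M))" "0 < (1::real)" "(\<lambda>b. b) (1 / nu M) / EW M = crit"
    using nu by (auto intro!: derivative_eq_intros)
  show ?thesis
  proof (intro conjI impI allI; (elim conjE)?)
    assume "integrable M (\<lambda>x. x ^ 4)"
    note \<Theta> = fourth_moment_bigtheta[OF this]
    show "has_crit_exps M sinh (arsinh (1 / nu M)) (1/2) 3 1 1"
      using crit_exps_of_gap[OF \<Theta> _ sinh] by simp
    show "has_crit_exps M (\<lambda>b. b) (1 / nu M) (1/2) 3 1 1"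
      using crit_exps_of_gap[OF \<Theta> _ id] by simp
  next
    fix \<tau> assume \<tau>: "power_law M \<tau>" "3 < \<tau>" "\<tau> < 5"
    note \<Theta> = power_law_bigtheta[OF \<tau>]
    show "has_crit_exps M sinh (arsinh (1 / nu M)) (1 / (\<tau> - 3)) (\<tau> - 2) 1 1"
      using crit_exps_of_gap[OF \<Theta> _ sinh] \<tau> by simp
    show "has_crit_exps M (\<lambda>b. b) (1 / nu M) (1 / (\<tau> - 3)) (\<tau> - 2) 1 1"
      using crit_exps_of_gap[OF \<Theta> _ id] \<tau> by simp
  next
    assume "power_law M 5"
    note \<Theta> = power_law_five_bigtheta[OF this]
    show "boundary_behaviour M sinh (arsinh (1 / nu M))" by (rule boundary_of_gap[OF \<Theta> sinh])
    show "boundary_behaviour M (\<lambda>b. b) (1 / nu M)" by (rule boundary_of_gap[OF \<Theta> id])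
  qed
qed

end
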